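(* Let $G$ be a graph of order $n\ge 6$. Then $$\sigma_1(G)+\sigma_1(\overline{G})\ \le\ \frac{27}{64}\cdot 2^n+\frac{1}{2}(n+2)(n-3),$$ with equality if and only if $G$ is isomorphic to $3K_2\cup\overline{K_{n-6}}$ or to $K_{n-6}\vee G_{6,4}$, where $G_{6,4}$ is the connected $4$-regular graph of order $6$, i.e. $G_{6,4}\cong\overline{3K_2}$.
   Context: All graphs are finite, simple and undirected; the order of a graph is its number of vertices. $\overline{G}$ denotes the complement of $G$ (same vertex set, two distinct vertices being adjacent in $\overline{G}$ iff they are not adjacent in $G$). $K_m$ is the complete graph on $m$ vertices and $\overline{K_m}$ the edgeless graph on $m$ vertices. $G_1\cup G_2$ denotes the disjoint union of graphs, $3K_2$ is the disjoint union of three copies of $K_2$, and $3K_2\cup\overline{K_{n-6}}$ is the graph consisting of three disjoint copies of $K_2$ together with $n-6$ isolated vertices. The join $G_1\vee G_2$ of disjoint graphs is obtained from $G_1\cup G_2$ by adding all edges $uv$ with $u\in V(G_1)$, $v\in V(G_2)$. When $n=6$ the parts $\overline{K_{n-6}}$ and $K_{n-6}$ have no vertices, so the two graphs are $3K_2$ and $\overline{3K_2}$. A subset $S\subseteq V(G)$ is called a $1$-nearly independent vertex subset of $G$ if the subgraph of $G$ induced by $S$ contains exactly one edge; $\sigma_1(G)$ denotes the number of $1$-nearly independent vertex subsets of $G$. *)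

theory Defs
  imports Complex_Main
begin

record 'a graph =
  verts :: "'a set"
  edges :: "'a set set"

definition all_pairs :: "'a set \<Rightarrow> 'a set set" where
  "all_pairs V = {e. e \<subseteq> V \<and> card e = 2}"

definition simple_graph :: "'a graph \<Rightarrow> bool" where
  "simple_graph G \<longleftrightarrow> finite (verts G) \<and> edges G \<subseteq> all_pairs (verts G)"

definition order :: "'a graph \<Rightarrow> nat" where
  "order G = card (verts G)"

definition complement :: "'a graph \<Rightarrow> 'a graph" where
  "complement G = \<lparr>verts = verts G, edges = all_pairs (verts G) - edges G\<rparr>"

definition complete_graph :: "nat \<Rightarrow> nat graph" where
  "complete_graph m = \<lparr>verts = {..<m}, edges = all_pairs {..<m}\<rparr>"

definition edgeless_graph :: "nat \<Rightarrow> nat graph" where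
  "edgeless_graph m = \<lparr>verts = {..<m}, edges = {}\<rparr>"

text \<open>Disjointness in unions and joins is enforced by passing to the sum type.\<close>

definition disjoint_union :: "'a graph \<Rightarrow> 'b graph \<Rightarrow> ('a + 'b) graph" where
  "disjoint_union G H =
     \<lparr>verts = verts G <+> verts H,
      edges = (\<lambda>e. Inl ` e) ` edges G \<union> (\<lambda>e. Inr ` e) ` edges H\<rparr>"

definition join :: "'a graph \<Rightarrow> 'b graph \<Rightarrow> ('a + 'b) graph" where
  "join G H =
     \<lparr>verts = verts (disjoint_union G H),
      edges = edges (disjoint_union G H) \<union> {{Inl u, Inr v} | u v. u \<in> verts G \<and> v \<in> verts H}\<rparr>"

definition isomorphic :: "'a graph \<Rightarrow> 'b graph \<Rightarrow> bool" where
  "isomorphic G H \<longleftrightarrow>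
     (\<exists>f. bij_betw f (verts G) (verts H) \<and>
          (\<forall>u\<in>verts G. \<forall>v\<in>verts G. {u, v} \<in> edges G \<longleftrightarrow> {f u, f v} \<in> edges H))"

definition induced_subgraph :: "'a graph \<Rightarrow> 'a set \<Rightarrow> 'a graph" where
  "induced_subgraph G S = \<lparr>verts = S, edges = {e \<in> edges G. e \<subseteq> S}\<rparr>"

definition nearly_independent1 :: "'a graph \<Rightarrow> 'a set \<Rightarrow> bool" where
  "nearly_independent1 G S \<longleftrightarrow>
     S \<subseteq> verts G \<and> card (edges (induced_subgraph G S)) = 1"

definition sigma1 :: "'a graph \<Rightarrow> nat" where
  "sigma1 G = card {S. nearly_independent1 G S}"

definition three_K2 :: "((nat + nat) + nat) graph" where
  "three_K2 = disjoint_union (disjoint_union (complete_graph 2) (complete_graph 2)) (complete_graph 2)"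

definition G64 :: "((nat + nat) + nat) graph" where
  "G64 = complement three_K2"

text \<open>The graph \<open>G64\<close> is indeed connected and 4-regular of order 6.\<close>

lemma all_pairs_two: "all_pairs {..<2::nat} = {{0, 1}}"
proof -
  have "e = {0, 1}" if "e \<subseteq> {..<2}" "card e = 2" for e :: "nat set"
    using card_subset_eq[of "{..<2}" e] that by auto
  then show ?thesis by (auto simp: all_pairs_def)
qed

lemma verts_three_K2:
  "verts three_K2 = {Inl (Inl 0), Inl (Inl 1), Inl (Inr 0), Inl (Inr 1), Inr 0, Inr 1}"
  by (auto simp: three_K2_def disjoint_union_def complete_graph_def less_2_cases_iff)

lemma edges_three_K2:
  "edges three_K2 = {{Inl (Inl 0), Inl (Inl 1)}, {Inl (Inr 0), Inl (Inr 1)}, {Inr 0, Inr 1}}"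
  by (auto simp: three_K2_def disjoint_union_def complete_graph_def all_pairs_two)

lemma verts_G64: "verts G64 = verts three_K2"
  by (simp add: G64_def complement_def)

lemma pair_in_all_pairs: "{u, v} \<in> all_pairs V \<longleftrightarrow> u \<in> V \<and> v \<in> V \<and> u \<noteq> v"
  by (auto simp: all_pairs_def card_insert_if)

lemma edge_G64_iff:
  "{u, v} \<in> edges G64 \<longleftrightarrow>
     u \<in> verts three_K2 \<and> v \<in> verts three_K2 \<and> u \<noteq> v \<and> {u, v} \<notin> edges three_K2"
  by (auto simp: G64_def complement_def pair_in_all_pairs)

lemma order_G64: "order G64 = 6"
  by (simp add: order_def verts_G64 verts_three_K2)

lemma regular_G64:
  assumes "u \<in> verts G64"
  shows "card {v \<in> verts G64. {u, v} \<in> edges G64} = 4"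
proof -
  have "card {v \<in> verts G64. {u, v} \<in> edges G64} =
      card {v \<in> verts three_K2. u \<noteq> v \<and> {u, v} \<notin> edges three_K2}"
    using assms unfolding verts_G64 edge_G64_iff by (intro arg_cong[where f = card]) blast
  also have "\<dots> = (\<Sum>v\<in>verts three_K2. if u \<noteq> v \<and> {u, v} \<notin> edges three_K2 then 1 else 0)"
    by (subst sum.inter_filter[symmetric]) (simp_all add: verts_three_K2)
  also have "\<dots> = 4"
    using assms unfolding verts_G64 verts_three_K2 edges_three_K2
    by (elim insertE emptyE; simp add: doubleton_eq_iff)
  finally show ?thesis .
qed

lemma connected_G64:
  assumes "u \<in> verts G64" "v \<in> verts G64"
  shows "(u, v) \<in> {(x, y). {x, y} \<in> edges G64}\<^sup>*"
proof -
  have "u = v \<or> {u, v} \<in> edges G64 \<or> (\<exists>w\<in>verts G64. {u, w} \<in> edges G64 \<and> {w, v} \<in> edges G64)"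
    using assms
    unfolding edge_G64_iff verts_G64 verts_three_K2 edges_three_K2
    by (elim insertE emptyE; simp add: doubleton_eq_iff)
  then show ?thesis
  proof (elim disjE bexE conjE)
    fix w assume "{u, w} \<in> edges G64" "{w, v} \<in> edges G64"
    then have "(u, w) \<in> {(x, y). {x, y} \<in> edges G64}\<^sup>*" "(w, v) \<in> {(x, y). {x, y} \<in> edges G64}\<^sup>*"
      by auto
    then show ?thesis
      by (rule rtrancl_trans)
  qed auto
qed

end

theory Submission
  imports Defs
begin

text \<open>
  No vertex subset induces exactly one edge in both \<open>G\<close> and its complement, so the sum counts the
  sets that induce exactly one edge or miss exactly one. Isolated vertices aside, a non-extremal
  graph on \<open>n \<ge> 6\<close> vertices has a vertex \<open>v\<close> lying in fewer than \<open>27/64 \<cdot> 2 ^ (n - 1) + (n - 1)\<close> such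
  sets, and deleting \<open>v\<close> gives the strict bound by induction. If \<open>v\<close> has at least 3 neighbours and at
  least 3 non-neighbours, the number of such sets through \<open>v\<close> is bounded by a linear function of the
  number of edges between the two parts, hence by its values at no and at all such edges. Up to
  complementation there remain a vertex of degree 2, which is a direct case distinction, and graphs
  with all degrees 1 or \<open>n - 2\<close>: there a leaf either has a neighbour of large degree, or the graph is a
  perfect matching. Finally, an isolated vertex doubles the number of sets inducing one edge, whose
  density is at most \<open>27/64\<close> in any graph; this is the only step through which equality persists.
\<close>

section \<open>Removing a vertex\<close>

text \<open>The constant 27/64 comes from disjoint edges: if \<open>k\<close> of them cover all
  \<open>2 * k\<close> vertices, the sets inducing one edge have density
  \<open>k * 3 ^ (k - 1) / 4 ^ k\<close>, which is largest at \<open>k = 3\<close> and, with the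
  same value, at \<open>k = 4\<close>. Density alone therefore does not single out the extremal
  graphs. The complement breaks the tie: with disjoint edges only, it contributes exactly its own
  edges, \<open>n choose 2\<close> minus \<open>k\<close>, and \<open>(n + 2) * (n - 3) / 2\<close>
  is \<open>(n choose 2) - 3\<close>.

  From order \<open>n\<close> to \<open>n + 1\<close> the claimed bound grows by
  \<open>27/64 * 2 ^ n + n\<close>, which is the threshold for the sets through one vertex. The
  crude density \<open>d / 2 ^ d\<close> of the sets in which a vertex of degree \<open>d\<close>
  meets the single edge is below 27/64 from \<open>d = 3\<close> on, but it is 1/2 for degrees 1 and
  2; hence the structural work for small degrees.

  The induction starts at order five, where the bound is 20.5 and cannot be attained, so no equality
  case has to be classified there. At order six, three disjoint edges leave no isolated vertex and
  are counted directly.\<close>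

text \<open>A graph is given by its vertex set \<open>V\<close> and an arbitrary set \<open>E\<close> of sets, of which only the
  pairs inside \<open>V\<close> matter; its complement is then simply given by \<open>- E\<close>.\<close>

definition num_edges :: "'a set set \<Rightarrow> 'a set \<Rightarrow> nat" where
  "num_edges E S = card (all_pairs S \<inter> E)"

definition num_indep :: "'a set set \<Rightarrow> 'a set \<Rightarrow> nat" where
  "num_indep E V = card {S. S \<subseteq> V \<and> num_edges E S = 0}"

definition num_near :: "'a set set \<Rightarrow> 'a set \<Rightarrow> nat" where
  "num_near E V = card {S. S \<subseteq> V \<and> num_edges E S = 1}"

definition nbh :: "'a set set \<Rightarrow> 'a set \<Rightarrow> 'a \<Rightarrow> 'a set" where
  "nbh E V v = {u \<in> V. u \<noteq> v \<and> {u, v} \<in> E}"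

definition near_total :: "'a set set \<Rightarrow> 'a set \<Rightarrow> nat" where
  "near_total E V = num_near E V + num_near (- E) V"

lemma near_total_compl: "near_total (- E) V = near_total E V"
  by (simp add: near_total_def)

lemma nbh_subset: "nbh E V v \<subseteq> V"
  by (auto simp: nbh_def)

lemma finite_nbh [simp]: "finite V \<Longrightarrow> finite (nbh E V v)"
  by (simp add: nbh_def)

lemma nbh_sym: "u \<in> nbh E V v \<Longrightarrow> v \<in> V \<Longrightarrow> v \<in> nbh E V u"
  by (auto simp: nbh_def insert_commute)

lemma finite_all_pairs: "finite S \<Longrightarrow> finite (all_pairs S)"
  by (rule finite_subset[of _ "Pow S"]) (auto simp: all_pairs_def)

lemma all_pairs_insert:
  assumes "v \<notin> S"
  shows "all_pairs (insert v S) = all_pairs S \<union> (\<lambda>u. {u, v}) ` S"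
proof (intro equalityI subsetI)
  fix e assume e: "e \<in> all_pairs (insert v S)"
  show "e \<in> all_pairs S \<union> (\<lambda>u. {u, v}) ` S"
  proof (cases "v \<in> e")
    case True
    obtain a b where "e = {a, b}" "a \<noteq> b"
      using e by (auto simp: all_pairs_def card_2_iff)
    with True e have "e \<in> (\<lambda>u. {u, v}) ` S"
      by (auto simp: pair_in_all_pairs insert_commute)
    then show ?thesis by blast
  next
    case False
    with e show ?thesis by (auto simp: all_pairs_def)
  qed
next
  fix e assume "e \<in> all_pairs S \<union> (\<lambda>u. {u, v}) ` S"
  with assms show "e \<in> all_pairs (insert v S)"
    by (auto simp: all_pairs_def pair_in_all_pairs card_insert_if)
qed

lemma num_edges_insert:
  assumes "finite S" "v \<notin> S"
  shows "num_edges E (insert v S) = num_edges E S + card (nbh E S v)"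
proof -
  have eq: "all_pairs (insert v S) \<inter> E = (all_pairs S \<inter> E) \<union> (\<lambda>u. {u, v}) ` nbh E S v"
    using assms by (auto simp: all_pairs_insert nbh_def)
  have "card ((\<lambda>u. {u, v}) ` nbh E S v) = card (nbh E S v)"
    by (rule card_image) (auto simp: inj_on_def doubleton_eq_iff)
  moreover have "(all_pairs S \<inter> E) \<inter> (\<lambda>u. {u, v}) ` nbh E S v = {}"
    using assms by (auto simp: all_pairs_def)
  ultimately show ?thesis
    unfolding num_edges_def eq using assms
    by (subst card_Un_disjoint) (simp_all add: finite_all_pairs)
qed

lemma card_subsets_insert:
  assumes "finite V" "v \<notin> V"
  shows "card {S. S \<subseteq> insert v V \<and> P S}
       = card {S. S \<subseteq> V \<and> P S} + card {S. S \<subseteq> V \<and> P (insert v S)}"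
proof -
  have fin: "finite {S. S \<subseteq> V \<and> Q S}" for Q
    using assms by simp
  have eq: "{S. S \<subseteq> insert v V \<and> P S}
      = {S. S \<subseteq> V \<and> P S} \<union> insert v ` {S. S \<subseteq> V \<and> P (insert v S)}"
  proof (intro equalityI subsetI)
    fix S assume S: "S \<in> {S. S \<subseteq> insert v V \<and> P S}"
    show "S \<in> {S. S \<subseteq> V \<and> P S} \<union> insert v ` {S. S \<subseteq> V \<and> P (insert v S)}"
    proof (cases "v \<in> S")
      case True
      then have "S = insert v (S - {v})" by auto
      with S have "S \<in> insert v ` {S. S \<subseteq> V \<and> P (insert v S)}"
        by (intro image_eqI[of _ _ "S - {v}"]) auto
      then show ?thesis by blast
    qed (use S in auto)
  qed auto
  have inj: "inj_on (insert v) {S. S \<subseteq> V \<and> P (insert v S)}"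
    using assms(2) by (intro inj_onI) (auto simp: insert_ident subset_iff)
  show ?thesis
    unfolding eq using assms fin
    by (subst card_Un_disjoint) (auto simp: card_image[OF inj])
qed

lemma all_pairs_empty [simp]: "all_pairs {} = {}"
  unfolding all_pairs_def by fastforce

lemma num_edges_empty [simp]: "num_edges E {} = 0"
  by (simp add: num_edges_def)

lemma num_indep_empty [simp]: "num_indep E {} = 1"
  by (simp add: num_indep_def cong: conj_cong)

lemma num_near_empty [simp]: "num_near E {} = 0"
  by (simp add: num_near_def cong: conj_cong)

lemma nbh_subset_restrict: "S \<subseteq> V \<Longrightarrow> nbh E S v = S \<inter> nbh E V v"
  by (auto simp: nbh_def)

lemma num_indep_insert:
  assumes "finite V" "v \<notin> V"
  shows "num_indep E (insert v V) = num_indep E V + num_indep E (V - nbh E V v)"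
proof -
  have "num_edges E (insert v S) = 0 \<longleftrightarrow> S \<inter> nbh E V v = {} \<and> num_edges E S = 0"
    if "S \<subseteq> V" for S
  proof -
    have "finite S" "v \<notin> S" using that assms finite_subset by auto
    then show ?thesis
      using that by (auto simp: num_edges_insert nbh_subset_restrict)
  qed
  then have "{S. S \<subseteq> V \<and> num_edges E (insert v S) = 0}
      = {S. S \<subseteq> V - nbh E V v \<and> num_edges E S = 0}"
    by auto
  then show ?thesis
    unfolding num_indep_def using assms by (simp add: card_subsets_insert)
qed

text \<open>A set through \<open>v\<close> with a single edge either avoids all neighbours of
  \<open>v\<close> and has its edge in \<open>H\<close>, or it contains exactly one neighbour
  \<open>u\<close>, the edge is \<open>{u, v}\<close>, and the rest is independent and avoids the
  neighbours of \<open>u\<close>. The sets of the second kind, with \<open>v\<close> removed, form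
  \<open>F u\<close>.\<close>

lemma num_near_insert:
  fixes E :: "'a set set"
  assumes "finite V" "v \<notin> V"
  defines "N \<equiv> nbh E V v"
  defines "H \<equiv> V - N"
  shows "num_near E (insert v V)
       = num_near E V + num_near E H + (\<Sum>u\<in>N. num_indep E (H - nbh E H u))"
proof -
  define F where "F u = insert u ` {S. S \<subseteq> H - nbh E H u \<and> num_edges E S = 0}" for u
  have N: "N \<subseteq> V" unfolding N_def by (rule nbh_subset)
  then have fin: "finite N" "finite H" using assms finite_subset by auto
  have split: "num_edges E (insert v S) = 1 \<longleftrightarrow>
      S \<subseteq> H \<and> num_edges E S = 1 \<or> (\<exists>u\<in>N. S \<in> F u)" (is "?L \<longleftrightarrow> ?R")
    if S: "S \<subseteq> V" for S
  proof -
    have finS: "finite S" "v \<notin> S" using S assms finite_subset by auto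
    have e: "num_edges E (insert v S) = num_edges E S + card (S \<inter> N)"
      using finS S by (simp add: num_edges_insert nbh_subset_restrict[OF S] N_def)
    have one: "num_edges E (insert u T) = card (nbh E T u) + num_edges E T"
      if "T \<subseteq> H" "u \<in> N" for T u
    proof -
      have "u \<notin> T" using that unfolding H_def by blast
      moreover have "finite T" using that(1) fin(2) by (rule finite_subset)
      ultimately show ?thesis
        using num_edges_insert[of T u E] by linarith
    qed
    show ?thesis
    proof
      assume ?L
      then consider "num_edges E S = 1" "card (S \<inter> N) = 0" | "num_edges E S = 0" "card (S \<inter> N) = 1"
        using e by linarith
      then show ?R
      proof cases
        case 1
        then show ?thesis using S finS by (auto simp: H_def)
      next
        case 2
        then obtain u where u: "S \<inter> N = {u}" by (auto simp: card_1_singleton_iff)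
        define T where "T = S - {u}"
        have ST: "S = insert u T" "u \<notin> T" "T \<subseteq> H" "u \<in> N"
          using u S by (auto simp: T_def H_def)
        have "card (nbh E T u) = 0" "num_edges E T = 0"
          using one[OF ST(3,4)] 2(1) ST(1) by auto
        then have "T \<subseteq> H - nbh E H u"
          using ST finS nbh_subset_restrict[OF ST(3), of E u] by auto
        with ST \<open>num_edges E T = 0\<close> show ?thesis
          by (auto simp: F_def)
      qed
    next
      assume ?R
      then show ?L
      proof (elim disjE bexE)
        assume "S \<subseteq> H \<and> num_edges E S = 1"
        moreover from this have "S \<inter> N = {}" by (auto simp: H_def)
        ultimately show ?L by (simp add: e)
      next
        fix u assume u: "u \<in> N" "S \<in> F u"
        then obtain T where T: "S = insert u T" "T \<subseteq> H - nbh E H u" "num_edges E T = 0"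
          by (auto simp: F_def)
        then have TH: "T \<subseteq> H" by blast
        have "nbh E T u = {}" using T nbh_subset_restrict[OF TH, of E u] by auto
        then have "num_edges E S = 0" using one[OF TH u(1)] T by simp
        moreover have "S \<inter> N = {u}" using T u TH by (auto simp: H_def)
        ultimately show ?L by (simp add: e)
      qed
    qed
  qed
  have FV: "S \<subseteq> V" if "S \<in> F u" "u \<in> N" for S u
    using that N by (auto simp: F_def H_def)
  have eq: "{S. S \<subseteq> V \<and> num_edges E (insert v S) = 1}
      = {S. S \<subseteq> H \<and> num_edges E S = 1} \<union> (\<Union>u\<in>N. F u)"
  proof -
    have "H \<subseteq> V" by (auto simp: H_def)
    then have "S \<in> {S. S \<subseteq> V \<and> num_edges E (insert v S) = 1} \<longleftrightarrow>
        S \<in> {S. S \<subseteq> H \<and> num_edges E S = 1} \<union> (\<Union>u\<in>N. F u)" for S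
      using split[of S] FV[of S] by (cases "S \<subseteq> V") auto
    then show ?thesis by (rule set_eqI)
  qed
  have finF: "finite (F u)" for u
    using fin by (auto simp: F_def)
  have FN: "S \<inter> N = {u}" if "S \<in> F u" "u \<in> N" for S u
    using that by (auto simp: F_def H_def)
  have cardF: "card (F u) = num_indep E (H - nbh E H u)" if "u \<in> N" for u
  proof -
    have "u \<notin> H" using that by (simp add: H_def)
    then have "inj_on (insert u) {S. S \<subseteq> H - nbh E H u \<and> num_edges E S = 0}"
      by (intro inj_onI) (auto simp: insert_ident subset_iff)
    then show ?thesis by (simp add: F_def num_indep_def card_image)
  qed
  have "card (\<Union>u\<in>N. F u) = (\<Sum>u\<in>N. card (F u))"
    using fin finF FN by (intro card_UN_disjoint) (simp_all, blast)
  also have "\<dots> = (\<Sum>u\<in>N. num_indep E (H - nbh E H u))"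
    using cardF by simp
  finally have cU: "card (\<Union>u\<in>N. F u) = (\<Sum>u\<in>N. num_indep E (H - nbh E H u))" .
  have "{S. S \<subseteq> H \<and> num_edges E S = 1} \<inter> (\<Union>u\<in>N. F u) = {}"
  proof -
    have False if "S \<subseteq> H" "u \<in> N" "S \<in> F u" for S u
    proof -
      have "S \<inter> N = {}" using that(1) by (auto simp: H_def)
      with FN[OF that(3,2)] show False by simp
    qed
    then show ?thesis by blast
  qed
  then have "card {S. S \<subseteq> V \<and> num_edges E (insert v S) = 1}
      = num_near E H + (\<Sum>u\<in>N. num_indep E (H - nbh E H u))"
    unfolding eq using fin finF cU by (subst card_Un_disjoint) (simp_all add: num_near_def)
  then show ?thesis
    unfolding num_near_def using assms(1,2) by (simp add: card_subsets_insert)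
qed

lemma num_indep_remove:
  assumes "finite V" "v \<in> V"
  shows "num_indep E V = num_indep E (V - {v}) + num_indep E (V - insert v (nbh E V v))"
proof -
  have "insert v (V - {v}) = V" "nbh E (V - {v}) v = nbh E V v"
    "V - {v} - nbh E V v = V - insert v (nbh E V v)"
    using assms by (auto simp: nbh_def)
  then show ?thesis
    using num_indep_insert[of "V - {v}" v E] assms by simp
qed

lemma num_near_remove:
  assumes "finite V" "v \<in> V"
  shows "num_near E V = num_near E (V - {v}) + num_near E (V - insert v (nbh E V v))
     + (\<Sum>u\<in>nbh E V v. num_indep E (V - insert v (nbh E V v) - nbh E V u))"
proof -
  have "insert v (V - {v}) = V" "nbh E (V - {v}) v = nbh E V v"
    "V - {v} - nbh E V v = V - insert v (nbh E V v)"
    using assms by (auto simp: nbh_def)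
  moreover have "V - insert v (nbh E V v) - nbh E (V - insert v (nbh E V v)) u
      = V - insert v (nbh E V v) - nbh E V u" for u
    by (auto simp: nbh_def)
  ultimately show ?thesis
    using num_near_insert[of "V - {v}" v E] assms by simp
qed

text \<open>The sets through \<open>v\<close> counted by \<open>near_total\<close>. In the complement the neighbours \<open>N\<close> and the
  non-neighbours \<open>H\<close> exchange roles, which gives the second summand of each kind.\<close>

definition gain :: "'a set set \<Rightarrow> 'a set \<Rightarrow> 'a \<Rightarrow> nat" where
  "gain E V v = (let N = nbh E V v; H = V - insert v N in
     num_near E H + num_near (- E) N + (\<Sum>u\<in>N. num_indep E (H - nbh E V u))
     + (\<Sum>w\<in>H. num_indep (- E) (N \<inter> nbh E V w)))"

lemma nbh_compl_remove:
  assumes "v \<in> V"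
  shows "nbh (- E) V v = V - insert v (nbh E V v)"
    and "V - insert v (nbh (- E) V v) = nbh E V v"
  using assms by (auto simp: nbh_def)

lemma near_total_remove:
  assumes "finite V" "v \<in> V"
  shows "near_total E V = near_total E (V - {v}) + gain E V v"
proof -
  \<comment> \<open>This rewrites the complement's sum in the form used by \<open>gain\<close>:
    removing the complement-neighbours of \<open>w\<close> from the neighbours of \<open>v\<close>
    keeps the neighbours of \<open>w\<close>.\<close>
  have "nbh E V v - nbh (- E) V w = nbh E V v \<inter> nbh E V w" if "w \<in> V - insert v (nbh E V v)" for w
    using that by (auto simp: nbh_def)
  then show ?thesis
    unfolding near_total_def gain_def Let_def
    using num_near_remove[OF assms, of E] num_near_remove[OF assms, of "- E"]
    unfolding nbh_compl_remove(2)[OF assms(2)] unfolding nbh_compl_remove(1)[OF assms(2)] by simp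
qed

text \<open>Both sides are the increase, on restoring \<open>v\<close>, of the same
  complement-invariant number.\<close>

lemma gain_compl:
  assumes "finite V" "v \<in> V"
  shows "gain (- E) V v = gain E V v"
  using near_total_remove[OF assms, of E] near_total_remove[OF assms, of "- E"]
  by (simp add: near_total_compl)

text \<open>The two families are disjoint. Later this trades one count against the other, where
  bounding each separately would be too expensive.\<close>

lemma num_indep_add_near_le:
  assumes "finite V"
  shows "num_indep E V + num_near E V \<le> 2 ^ card V"
proof -
  have "num_indep E V + num_near E V
      = card ({S. S \<subseteq> V \<and> num_edges E S = 0} \<union> {S. S \<subseteq> V \<and> num_edges E S = 1})"
    unfolding num_indep_def num_near_def using assms by (subst card_Un_disjoint) auto
  also have "\<dots> \<le> card (Pow V)"
    using assms by (intro card_mono) auto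
  finally show ?thesis using assms by (simp add: card_Pow)
qed

lemma num_indep_le: "finite V \<Longrightarrow> num_indep E V \<le> 2 ^ card V"
  using num_indep_add_near_le[of V E] by simp

lemma num_indep_mono:
  assumes "finite V" "W \<subseteq> V"
  shows "num_indep E W \<le> num_indep E V"
  unfolding num_indep_def using assms by (intro card_mono) auto

lemma num_near_singleton [simp]: "num_near E {x} = 0"
  using num_near_remove[of "{x}" x E] by (auto simp: nbh_def)

lemma num_indep_diff_le:
  assumes "finite H"
  shows "num_indep E (H - A) \<le> 2 ^ (card H - card (H \<inter> A))"
proof -
  have "card (H - A) = card H - card (H \<inter> A)"
    using assms by (subst card_Diff_subset_Int) auto
  with num_indep_le[of "H - A" E] assms show ?thesis by simp
qed

text \<open>An isolated vertex can be added to any set without changing its edges, hence the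
  doubling. In the complement it is adjacent to everything, so it lies in a set with a single edge
  only if that set is a pair.\<close>

lemma
  assumes "finite V" "x \<in> V" "nbh E V x = {}"
  shows num_indep_isolated: "num_indep E V = 2 * num_indep E (V - {x})"
    and num_near_isolated: "num_near E V = 2 * num_near E (V - {x})"
    and num_near_compl_isolated: "num_near (- E) V = num_near (- E) (V - {x}) + (card V - 1)"
proof -
  show "num_indep E V = 2 * num_indep E (V - {x})"
    using num_indep_remove[OF assms(1,2), of E] assms(3) by simp
  show "num_near E V = 2 * num_near E (V - {x})"
    using num_near_remove[OF assms(1,2), of E] assms(3) by simp
  show "num_near (- E) V = num_near (- E) (V - {x}) + (card V - 1)"
    using num_near_remove[OF assms(1,2), of "- E"] assms
    unfolding nbh_compl_remove(2)[OF assms(2)] unfolding nbh_compl_remove(1)[OF assms(2)] by simp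
qed

text \<open>Three of the four subsets of an isolated edge are independent, and the fourth supplies
  the single edge. In the complement \<open>x\<close> and \<open>y\<close> are joined to all other
  vertices but not to each other, so the new sets are the pairs with one end in
  \<open>{x, y}\<close> and the other outside.\<close>

lemma
  assumes "finite V" "x \<in> V" "nbh E V x = {y}" "nbh E V y = {x}"
  shows num_indep_K2: "num_indep E V = 3 * num_indep E (V - {x, y})"
    and num_near_K2: "num_near E V = 3 * num_near E (V - {x, y}) + num_indep E (V - {x, y})"
    and num_near_compl_K2: "num_near (- E) V = num_near (- E) (V - {x, y}) + 2 * (card V - 2)"
proof -
  have xy: "y \<in> V" "x \<noteq> y" using assms(3) by (auto simp: nbh_def)
  have W: "V - {x} - {y} = V - {x, y}" by auto
  have y: "nbh E (V - {x}) y = {}" "finite (V - {x})" "y \<in> V - {x}"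
    using assms xy by (auto simp: nbh_def)
  have diff: "V - {x, y} - {x} = V - {x, y}" by auto
  show "num_indep E V = 3 * num_indep E (V - {x, y})"
    using num_indep_remove[OF assms(1,2), of E] assms(3) num_indep_isolated[OF y(2,3,1)]
    by (simp add: W)
  show "num_near E V = 3 * num_near E (V - {x, y}) + num_indep E (V - {x, y})"
    using num_near_remove[OF assms(1,2), of E] assms(3,4) num_near_isolated[OF y(2,3,1)]
    by (simp add: W diff)
  have e: "{y} - nbh (- E) V w = {}" if "w \<in> V - {x, y}" for w
  proof -
    have "w \<notin> nbh E V y" using that assms(4) by simp
    then show ?thesis using that xy by (auto simp: nbh_def insert_commute)
  qed
  have "card (V - {x, y}) = card V - 2"
    using assms xy by (subst card_Diff_subset) auto
  moreover have "card (V - {x}) - 1 = card V - 2"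
    using assms by simp
  ultimately show "num_near (- E) V = num_near (- E) (V - {x, y}) + 2 * (card V - 2)"
    using num_near_remove[OF assms(1,2), of "- E"] num_near_compl_isolated[OF y(2,3,1)] assms(3) e
    unfolding nbh_compl_remove(2)[OF assms(2)] unfolding nbh_compl_remove(1)[OF assms(2)] by (simp add: W)
qed

lemma card_remove_two:
  assumes "finite V" "u \<in> V" "w \<in> V" "w \<noteq> u"
  obtains m where "card V = Suc (Suc m)" "card (V - {u}) = Suc m" "card (V - {u, w}) = m"
proof -
  have "V = insert u (insert w (V - {u, w}))" "V - {u} = insert w (V - {u, w})"
    using assms by auto
  then have "card V = Suc (Suc (card (V - {u, w})))" "card (V - {u}) = Suc (card (V - {u, w}))"
    using assms card.insert[of "insert w (V - {u, w})" u] card.insert[of "V - {u, w}" w] by auto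
  then show thesis using that by blast
qed

lemma card_remove_two_eq:
  assumes "finite V" "u \<in> V" "w \<in> V" "w \<noteq> u"
  shows "card V = card (V - {u, w}) + 2"
  by (rule card_remove_two[OF assms]) simp

text \<open>An independent set meets a fixed edge in at most three of its four subsets.\<close>

lemma num_indep_edge:
  assumes "finite V" "u \<in> V" "nbh E V u \<noteq> {}"
  shows "4 * num_indep E V \<le> 3 * 2 ^ card V"
proof -
  obtain w where w: "w \<in> nbh E V u" using assms by auto
  then have uw: "w \<in> V" "w \<noteq> u" by (auto simp: nbh_def)
  then obtain m where m: "card V = Suc (Suc m)" "card (V - {u}) = Suc m" "card (V - {u, w}) = m"
    using card_remove_two[of V u w] assms by auto
  have "num_indep E (V - insert u (nbh E V u)) \<le> num_indep E (V - {u, w})"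
    using w assms(1) by (intro num_indep_mono) auto
  also have "\<dots> \<le> 2 ^ m" using num_indep_le[of "V - {u, w}" E] assms(1) m by simp
  finally show ?thesis
    using num_indep_remove[OF assms(1,2), of E] num_indep_le[of "V - {u}" E] assms(1) m by simp
qed

text \<open>Choose \<open>v\<close> so that an edge survives its deletion. Sets without
  \<open>v\<close> then contribute at most 3/4 of one half, and sets with \<open>v\<close> must
  avoid a neighbour, so they contribute at most 1/2 of the other half. The path of order three
  attains 5/8.\<close>

lemma num_indep_no_isolated:
  assumes "finite V" "card V \<ge> 3" and iso: "\<And>u. u \<in> V \<Longrightarrow> nbh E V u \<noteq> {}"
  shows "8 * num_indep E V \<le> 5 * 2 ^ card V"
proof -
  obtain v w where v: "v \<in> V" "w \<in> V - {v}" "nbh E (V - {v}) w \<noteq> {}"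
  proof -
    obtain x where x: "x \<in> V" using assms(2) by fastforce
    show thesis
    proof (cases "\<exists>w\<in>V - {x}. nbh E (V - {x}) w \<noteq> {}")
      case True
      then show ?thesis using that x by blast
    next
      case False
      \<comment> \<open>No edge avoids \<open>x\<close>, so the graph is a star with centre
        \<open>x\<close>. Deleting a leaf \<open>y\<close> keeps the edge from \<open>x\<close> to
        another leaf \<open>z\<close>; this is where a third vertex is required.\<close>
      have star: "x \<in> nbh E V w" if "w \<in> V - {x}" for w
      proof -
        have "nbh E V w \<noteq> {}" using iso[of w] that by simp
        then obtain z where "z \<in> nbh E V w" by auto
        with False that show ?thesis by (cases "z = x") (auto simp: nbh_def)
      qed
      have "\<not> card (V - {x}) \<le> Suc 0" using x assms(1,2) by simp
      then have "\<not> (\<forall>a\<in>V - {x}. \<forall>b\<in>V - {x}. a = b)"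
        using assms(1) by (subst card_le_Suc0_iff_eq[symmetric]) auto
      then obtain y z where yz: "y \<in> V - {x}" "z \<in> V - {x}" "y \<noteq> z"
        by blast
      then have "x \<in> nbh E (V - {y}) z" using star[of z] x by (auto simp: nbh_def)
      then show ?thesis using that[of y z] yz by blast
    qed
  qed
  obtain u where u: "u \<in> nbh E V v" using iso[OF v(1)] by auto
  then have uv: "u \<in> V" "u \<noteq> v" by (auto simp: nbh_def)
  then obtain m where m: "card V = Suc (Suc m)" "card (V - {v}) = Suc m" "card (V - {v, u}) = m"
    using card_remove_two[of V v u] assms v(1) by auto
  have "num_indep E (V - insert v (nbh E V v)) \<le> num_indep E (V - {v, u})"
    using u assms(1) by (intro num_indep_mono) auto
  also have "\<dots> \<le> 2 ^ m" using num_indep_le[of "V - {v, u}" E] assms(1) m by simp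
  finally have "8 * num_indep E V \<le> 2 * (4 * num_indep E (V - {v})) + 8 * 2 ^ m"
    using num_indep_remove[OF assms(1) v(1), of E] by simp
  also have "\<dots> \<le> 2 * (3 * 2 ^ Suc m) + 8 * 2 ^ m"
    using num_indep_edge[OF _ v(2,3)] assms(1) m by simp
  finally show ?thesis using m by simp
qed

section \<open>Perfect matchings\<close>

lemma nbh_K2_rest:
  assumes "nbh E V x = {y}" "nbh E V y = {x}" "w \<in> V - {x, y}"
  shows "nbh E (V - {x, y}) w = nbh E V w"
proof -
  have "x \<notin> nbh E V w" "y \<notin> nbh E V w"
    using assms nbh_sym[of x E V w] nbh_sym[of y E V w] by auto
  moreover have "nbh E V w \<subseteq> V" by (rule nbh_subset)
  moreover have "nbh E (V - {x, y}) w = (V - {x, y}) \<inter> nbh E V w"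
    by (rule nbh_subset_restrict) auto
  ultimately show ?thesis by auto
qed

lemma matching_partner:
  assumes "\<And>v. v \<in> V \<Longrightarrow> card (nbh E V v) = 1" "x \<in> V"
  obtains y where "y \<in> V" "y \<noteq> x" "nbh E V x = {y}" "nbh E V y = {x}"
    "\<And>w. w \<in> V - {x, y} \<Longrightarrow> card (nbh E (V - {x, y}) w) = 1"
proof -
  obtain y where y: "nbh E V x = {y}" using assms(1)[OF assms(2)] card_1_singletonE by blast
  then have yV: "y \<in> V" "y \<noteq> x" by (auto simp: nbh_def)
  have "x \<in> nbh E V y" using y assms(2) by (simp add: nbh_sym)
  then have x: "nbh E V y = {x}"
    using assms(1)[OF yV(1)] by (auto simp: card_1_singleton_iff)
  show thesis
    using assms(1) by (intro that[OF yV y x]) (simp add: nbh_K2_rest[OF y x])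
qed

text \<open>Each of the \<open>k\<close> edges offers three independent traces, and a set inducing
  one edge selects which edge is full. The factor 3 avoids the exponent \<open>k - 1\<close>. That
  the order is even is used later on its own.\<close>

lemma perfect_matching_counts:
  assumes "finite V" "\<And>v. v \<in> V \<Longrightarrow> card (nbh E V v) = 1"
  shows "\<exists>k. card V = 2 * k \<and> num_indep E V = 3 ^ k \<and> 3 * num_near E V = k * 3 ^ k"
  using assms
proof (induction "card V" arbitrary: V rule: less_induct)
  case less
  show ?case
  proof (cases "V = {}")
    case False
    then obtain x where x: "x \<in> V" by auto
    obtain y where y: "y \<in> V" "y \<noteq> x" "nbh E V x = {y}" "nbh E V y = {x}"
      "\<And>w. w \<in> V - {x, y} \<Longrightarrow> card (nbh E (V - {x, y}) w) = 1"
      using matching_partner[OF less.prems(2) x] by blast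
    have cV: "card V = card (V - {x, y}) + 2"
      using card_remove_two_eq[OF less.prems(1) x y(1,2)] .
    obtain k where k: "card (V - {x, y}) = 2 * k" "num_indep E (V - {x, y}) = 3 ^ k"
        "3 * num_near E (V - {x, y}) = k * 3 ^ k"
      using less.hyps[OF _ _ y(5)] cV less.prems(1) by auto
    have "card V = 2 * Suc k \<and> num_indep E V = 3 ^ Suc k \<and> 3 * num_near E V = Suc k * 3 ^ Suc k"
      using num_indep_K2[OF less.prems(1) x y(3,4)] num_near_K2[OF less.prems(1) x y(3,4)] k cV
      by simp
    then show ?thesis by blast
  qed (auto intro: exI[of _ 0])
qed

section \<open>Density of the sets inducing one edge\<close>

lemma card_vertex_split:
  assumes "finite V" "v \<in> V"
  shows "card V = Suc (card (nbh E V v) + card (V - insert v (nbh E V v)))"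
    and "card (V - {v}) = card (nbh E V v) + card (V - insert v (nbh E V v))"
proof -
  have "V - {v} = nbh E V v \<union> (V - insert v (nbh E V v))"
    using assms by (auto simp: nbh_def)
  then have "card (V - {v}) = card (nbh E V v \<union> (V - insert v (nbh E V v)))" by simp
  also have "\<dots> = card (nbh E V v) + card (V - insert v (nbh E V v))"
    using assms(1) by (intro card_Un_disjoint) auto
  finally show *: "card (V - {v}) = card (nbh E V v) + card (V - insert v (nbh E V v))" .
  with assms card_Suc_Diff1[OF assms] show "card V = Suc (card (nbh E V v) + card (V - insert v (nbh E V v)))"
    by simp
qed

text \<open>If no edge joins the neighbours of \<open>v\<close> to the rest, the rest is a union of
  components and inherits the absence of isolated vertices.\<close>

lemma nbh_rest_nonempty:
  assumes "nbh E V w \<noteq> {}" "w \<in> V - insert v (nbh E V v)"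
    and "\<And>u. u \<in> nbh E V v \<Longrightarrow> (V - insert v (nbh E V v)) \<inter> nbh E V u = {}"
  shows "nbh E (V - insert v (nbh E V v)) w \<noteq> {}"
proof -
  obtain z where z: "z \<in> nbh E V w" using assms(1) by auto
  then have wz: "w \<in> nbh E V z" using assms(2) by (simp add: nbh_sym)
  have "z \<noteq> v" using wz assms(2) by auto
  moreover have "z \<notin> nbh E V v" using wz assms(2,3) by blast
  moreover have "z \<in> V" using z nbh_subset by fast
  ultimately have "z \<in> nbh E (V - insert v (nbh E V v)) w"
    using z by (simp add: nbh_def)
  then show ?thesis by auto
qed

lemma num_indep_diff_half:
  assumes "finite H" "H \<inter> A \<noteq> {}"
  shows "2 * num_indep E (H - A) \<le> 2 ^ card H"
proof -
  have "card (H \<inter> A) > 0" "card (H \<inter> A) \<le> card H"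
    using assms by (auto simp: card_gt_0_iff intro: card_mono)
  then have "card H - card (H \<inter> A) \<le> card H - 1" "card H = Suc (card H - 1)" by simp_all
  then have "num_indep E (H - A) \<le> 2 ^ (card H - 1)"
    using num_indep_diff_le[OF assms(1), of E A]
    by (meson le_trans one_le_numeral power_increasing)
  then show ?thesis using \<open>card H = Suc (card H - 1)\<close>
    by (metis mult_le_mono2 power_Suc)
qed

text \<open>Fails for \<open>d = 1\<close> and \<open>d = 2\<close>, which is why these degrees are
  treated apart.\<close>

lemma mult_le_power_two: "3 \<le> d \<Longrightarrow> 64 * d \<le> 27 * 2 ^ d" for d :: nat
  by (induction d rule: nat_induct_at_least) auto

text \<open>From \<open>k = 3\<close> on, the ratio \<open>3 * (k + 1) / (4 * k)\<close> of
  consecutive terms of \<open>k * (3 / 4) ^ k\<close> is at most 1. Equality holds at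
  \<open>k = 3\<close> and \<open>k = 4\<close>.\<close>

lemma matching_density: "64 * (k * 3 ^ k) \<le> 81 * 4 ^ k" for k :: nat
proof (cases "k \<ge> 3")
  case True
  then show ?thesis
  proof (induction k rule: nat_induct_at_least)
    case (Suc k)
    have "64 * (Suc k * 3 ^ Suc k) = 64 * 3 ^ k * (3 * Suc k)" by (simp add: algebra_simps)
    also have "\<dots> \<le> 64 * 3 ^ k * (4 * k)" using Suc.hyps by (intro mult_le_mono2) simp
    also have "\<dots> = 4 * (64 * (k * 3 ^ k))" by simp
    also have "\<dots> \<le> 4 * (81 * 4 ^ k)" using Suc.IH by (rule mult_le_mono2)
    finally show ?case by simp
  qed simp
next
  case False
  then have "k = 0 \<or> k = 1 \<or> k = 2" by auto
  then show ?thesis by (elim disjE) simp_all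
qed

text \<open>The sets through the deleted vertex must have density at most 27/64. For degree 2 the
  crude estimate gives 1/2. If one of the two neighbours has a neighbour in \<open>H\<close>, one of
  the counts \<open>p\<close>, \<open>q\<close> is halved and the density drops to 3/8; otherwise
  \<open>H\<close> has no isolated vertex, and the 5/8 bound yields 13/32.\<close>

theorem num_near_bound:
  assumes "finite V"
  shows "64 * num_near E V \<le> 27 * 2 ^ card V"
  using assms
proof (induction "card V" arbitrary: V rule: less_induct)
  case less
  have smaller: "64 * num_near E W \<le> 27 * 2 ^ card W" if "W \<subset> V" for W
    using less.hyps[of W] psubset_card_mono[OF less.prems that] finite_subset[of W V] that less.prems by blast
  define N H where "N v = nbh E V v" and "H v = V - insert v (N v)" for v
  have fin: "finite (N v)" "finite (H v)" for v
    using less.prems by (auto simp: N_def H_def)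
  consider (empty) "V = {}"
    | (isolated) x where "x \<in> V" "N x = {}"
    | (large) v where "v \<in> V" "card (N v) \<ge> 3"
    | (two) v where "v \<in> V" "card (N v) = 2" "\<And>x. x \<in> V \<Longrightarrow> N x \<noteq> {}"
    | (matching) "\<And>v. v \<in> V \<Longrightarrow> card (N v) = 1"
  proof -
    have "card (N v) = 0 \<or> card (N v) = 1 \<or> card (N v) = 2 \<or> 3 \<le> card (N v)" for v
      by arith
    moreover have "N v = {}" if "card (N v) = 0" for v
      using that fin by simp
    ultimately show thesis using that by metis
  qed
  then show ?case
  proof cases
    case empty
    then show ?thesis by simp
  next
    case isolated
    have "card V = Suc (card (V - {x}))"
      using card_Suc_Diff1[OF less.prems isolated(1)] by simp
    moreover have "num_near E V = 2 * num_near E (V - {x})"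
      using num_near_isolated[OF less.prems isolated(1), of E] isolated(2) by (simp add: N_def)
    moreover have "64 * num_near E (V - {x}) \<le> 27 * 2 ^ card (V - {x})"
      by (rule smaller) (use isolated(1) in blast)
    ultimately show ?thesis by simp
  next
    case large
    have "(\<Sum>u\<in>N v. num_indep E (H v - nbh E V u)) \<le> (\<Sum>u\<in>N v. num_indep E (H v))"
      using fin by (intro sum_mono num_indep_mono) auto
    then have "num_near E V \<le> num_near E (V - {v}) + (num_near E (H v) + card (N v) * num_indep E (H v))"
      using num_near_remove[OF less.prems large(1), of E]
      unfolding N_def[symmetric] H_def[symmetric] by simp
    \<comment> \<open>As the degree is positive, the sets with their edge inside \<open>H\<close>
      fit into one of the \<open>card (N v)\<close> copies, each of which then costs at most all
      subsets of \<open>H\<close>.\<close>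
    moreover have "num_near E (H v) + card (N v) * num_indep E (H v)
        \<le> card (N v) * (num_indep E (H v) + num_near E (H v))"
      using large(2) by (cases "card (N v)") (auto simp: algebra_simps)
    moreover have "\<dots> \<le> card (N v) * 2 ^ card (H v)"
      using fin by (intro mult_le_mono2 num_indep_add_near_le) auto
    ultimately have near: "num_near E V \<le> num_near E (V - {v}) + card (N v) * 2 ^ card (H v)"
      by linarith
    have "64 * (card (N v) * 2 ^ card (H v)) \<le> 27 * 2 ^ (card (N v) + card (H v))"
      using mult_le_mono1[OF mult_le_power_two[OF large(2)], of "2 ^ card (H v)"]
      by (simp add: mult.assoc power_add)
    moreover have "64 * num_near E (V - {v}) \<le> 27 * 2 ^ (card (N v) + card (H v))"
      using smaller[of "V - {v}"] large(1) card_vertex_split(2)[OF less.prems large(1), of E]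
      unfolding N_def[symmetric] H_def[symmetric] by auto
    ultimately have "64 * num_near E V \<le> 27 * 2 ^ Suc (card (N v) + card (H v))"
      using near by simp
    then show ?thesis
      using card_vertex_split(1)[OF less.prems large(1), of E]
      unfolding N_def[symmetric] H_def[symmetric] by simp
  next
    case two
    obtain a b where ab: "N v = {a, b}" "a \<noteq> b" using two(2) by (auto simp: card_2_iff)
    define p q where "p = num_indep E (H v - nbh E V a)" and "q = num_indep E (H v - nbh E V b)"
    have near: "num_near E V = num_near E (V - {v}) + num_near E (H v) + (p + q)"
      using num_near_remove[OF less.prems two(1), of E] ab
      unfolding N_def[symmetric] H_def[symmetric] p_def q_def by simp
    have cV: "card V = 3 + card (H v)" "card (V - {v}) = 2 + card (H v)"
      using card_vertex_split[OF less.prems two(1), of E] two(2)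
      unfolding N_def[symmetric] H_def[symmetric] by simp_all
    have nearV: "64 * num_near E (V - {v}) \<le> 27 * 2 ^ (2 + card (H v))"
      using smaller[of "V - {v}"] two(1) cV by auto
    have nearH: "64 * num_near E (H v) \<le> 27 * 2 ^ card (H v)"
      by (rule smaller) (use two(1) in \<open>auto simp: H_def\<close>)
    have pq: "p \<le> num_indep E (H v)" "q \<le> num_indep E (H v)"
      unfolding p_def q_def using fin by (auto intro: num_indep_mono)
    have IN: "num_indep E (H v) + num_near E (H v) \<le> 2 ^ card (H v)"
      using fin by (intro num_indep_add_near_le) auto
    have half: "H v \<inter> nbh E V a \<noteq> {} \<Longrightarrow> 2 * p \<le> 2 ^ card (H v)"
      "H v \<inter> nbh E V b \<noteq> {} \<Longrightarrow> 2 * q \<le> 2 ^ card (H v)"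
      unfolding p_def q_def using fin by (auto intro: num_indep_diff_half)
    show ?thesis
    proof (cases "H v \<inter> nbh E V a = {} \<and> H v \<inter> nbh E V b = {}")
      case False
      then have "2 * p \<le> 2 ^ card (H v) \<or> 2 * q \<le> 2 ^ card (H v)" using half by blast
      then have "2 * (num_near E (H v) + (p + q)) \<le> 3 * 2 ^ card (H v)"
      proof (elim disjE)
        assume "2 * p \<le> 2 ^ card (H v)"
        moreover have "2 * (num_near E (H v) + q) \<le> 2 * 2 ^ card (H v)"
          using pq(2) IN by (intro mult_le_mono2) linarith
        ultimately show ?thesis by simp
      next
        assume "2 * q \<le> 2 ^ card (H v)"
        moreover have "2 * (num_near E (H v) + p) \<le> 2 * 2 ^ card (H v)"
          using pq(1) IN by (intro mult_le_mono2) linarith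
        ultimately show ?thesis by simp
      qed
      then show ?thesis using near nearV cV by (simp add: power_add)
    next
      case True
      have no_iso: "nbh E (H v) w \<noteq> {}" if "w \<in> H v" for w
        unfolding H_def N_def
        by (rule nbh_rest_nonempty) (use that True ab two(3) in \<open>auto simp: N_def H_def\<close>)
      \<comment> \<open>The 5/8 bound needs three vertices. For smaller \<open>H\<close>, rounding
        the inductive bound down to an integer suffices, and a single vertex would be
        isolated.\<close>
      consider "card (H v) = 0" | "card (H v) = 1" | "card (H v) = 2" | "card (H v) \<ge> 3" by linarith
      then show ?thesis
      proof cases
        case 1
        then have "H v = {}" using fin by simp
        then have "p = 1" "q = 1" "num_near E (H v) = 0" by (simp_all add: p_def q_def)
        moreover have "num_near E (V - {v}) \<le> 1" using nearV cV 1 by simp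
        ultimately show ?thesis using near cV 1 by simp
      next
        case 2
        then obtain w where "H v = {w}" by (auto simp: card_1_singleton_iff)
        with no_iso[of w] show ?thesis by (auto simp: nbh_def)
      next
        case 3
        then obtain w where w: "w \<in> H v" by fastforce
        have "4 * num_indep E (H v) \<le> 12"
          using num_indep_edge[OF _ w no_iso[OF w]] fin 3 by simp
        moreover have "num_near E (V - {v}) \<le> 6" using nearV cV 3 by simp
        ultimately show ?thesis using near cV 3 IN pq by simp
      next
        case 4
        then have "8 * num_indep E (H v) \<le> 5 * 2 ^ card (H v)"
          using fin no_iso by (intro num_indep_no_isolated) auto
        then have "8 * (num_near E (H v) + (p + q)) \<le> 13 * 2 ^ card (H v)"
          using mult_le_mono2[OF pq(1), of 8] mult_le_mono2[OF pq(2), of 8] mult_le_mono2[OF IN, of 8] by simp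
        then show ?thesis using near nearV cV by (simp add: power_add)
      qed
    qed
  next
    case matching
    then obtain k where "card V = 2 * k" "3 * num_near E V = k * 3 ^ k"
      using perfect_matching_counts[OF less.prems, of E] by (auto simp: N_def)
    then show ?thesis using matching_density[of k] by (simp add: power_mult)
  qed
qed

section \<open>Gain at a vertex\<close>

lemma num_indep_singleton [simp]: "num_indep E {x} = 2"
  using num_indep_remove[of "{x}" x E] by (auto simp: nbh_def)

lemma
  assumes "a \<noteq> b"
  shows num_indep_pair: "num_indep E {a, b} = (if {a, b} \<in> E then 3 else 4)"
    and num_near_pair: "num_near E {a, b} = (if {a, b} \<in> E then 1 else 0)"
proof -
  have nb: "nbh E {a, b} a = (if {a, b} \<in> E then {b} else {})"
    using assms by (auto simp: nbh_def insert_commute)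
  have rm: "{a, b} - {a} = {b}" "{a, b} - {a, b} = {}" using assms by auto
  show "num_indep E {a, b} = (if {a, b} \<in> E then 3 else 4)"
    using num_indep_remove[of "{a, b}" a E] rm by (simp add: nb)
  show "num_near E {a, b} = (if {a, b} \<in> E then 1 else 0)"
    using num_near_remove[of "{a, b}" a E] rm by (simp add: nb)
qed

lemma gain_isolated:
  assumes "finite V" "v \<in> V" "nbh E V v = {}"
  shows "gain E V v = num_near E (V - {v}) + (card V - 1)"
  using assms by (simp add: gain_def)

text \<open>In the complement \<open>v\<close> sees all of \<open>H\<close> but not
  \<open>u\<close>. The pair \<open>{v, w}\<close> is always counted, and adding \<open>u\<close>
  creates no further edge exactly when \<open>w\<close> is adjacent to \<open>u\<close> in the graph
  itself, so \<open>w\<close> contributes 1 or 2.\<close>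

lemma gain_pendant:
  assumes "finite V" "v \<in> V" "nbh E V v = {u}"
  defines "H \<equiv> V - {v, u}"
  shows "gain E V v = num_near E H + num_indep E (H - nbh E V u) + (card H + card (H \<inter> nbh E V u))"
proof -
  have "num_indep (- E) ({u} \<inter> nbh E V w) = 1 + of_bool (w \<in> nbh E V u)" if "w \<in> H" for w
  proof -
    have "u \<in> nbh E V w \<longleftrightarrow> w \<in> nbh E V u"
      using that assms(2,3) nbh_sym[of u E V w] nbh_sym[of w E V u] nbh_subset[of E V v] by (auto simp: H_def)
    then show ?thesis by (cases "w \<in> nbh E V u") simp_all
  qed
  then have "(\<Sum>w\<in>H. num_indep (- E) ({u} \<inter> nbh E V w)) = card H + card (H \<inter> nbh E V u)"
    using assms(1) by (simp add: sum.distrib sum_Suc sum_of_bool_eq Int_def H_def del: Int_insert_left)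
  then show ?thesis
    using assms(3) unfolding gain_def H_def by (simp add: Let_def del: Int_insert_left)
qed

text \<open>The last summand has two sources. If \<open>{a, b}\<close> is an edge, a common
  neighbour \<open>w\<close> admits all four subsets of \<open>{a, b}\<close>, one more than 1 + 1 +
  1. If it is not, \<open>{v, a, b}\<close> itself induces a single edge in the complement.\<close>

lemma gain_two:
  assumes "finite V" "v \<in> V" "nbh E V v = {a, b}" "a \<noteq> b"
  defines "H \<equiv> V - {v, a, b}"
  shows "gain E V v = num_near E H + num_indep E (H - nbh E V a) + num_indep E (H - nbh E V b)
      + (card H + card (H \<inter> nbh E V a) + card (H \<inter> nbh E V b)
         + (if {a, b} \<in> E then card (H \<inter> nbh E V a \<inter> nbh E V b) else 1))"
proof -
  have sum: "(\<Sum>w\<in>H. num_indep (- E) ({a, b} \<inter> nbh E V w))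
      = card H + card (H \<inter> nbh E V a) + card (H \<inter> nbh E V b)
        + (if {a, b} \<in> E then card (H \<inter> nbh E V a \<inter> nbh E V b) else 0)"
  proof -
    have "num_indep (- E) ({a, b} \<inter> nbh E V w)
        = 1 + of_bool (w \<in> nbh E V a) + of_bool (w \<in> nbh E V b)
          + (if {a, b} \<in> E then of_bool (w \<in> nbh E V a \<inter> nbh E V b) else 0)" if "w \<in> H" for w
    proof -
      have "a \<in> V" "b \<in> V" "w \<in> V" using that assms(3) nbh_subset[of E V v] by (auto simp: H_def)
      then have "a \<in> nbh E V w \<longleftrightarrow> w \<in> nbh E V a" "b \<in> nbh E V w \<longleftrightarrow> w \<in> nbh E V b"
        using nbh_sym by fast+
      then show ?thesis using assms(4)
        by (cases "w \<in> nbh E V a"; cases "w \<in> nbh E V b")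
          (simp_all add: num_indep_pair)
    qed
    then show ?thesis
      using assms(1)
      by (simp add: sum.distrib sum_Suc sum_of_bool_eq Int_def H_def Int_assoc del: Int_insert_left)
  qed
  have "{a, b} \<in> - E \<longleftrightarrow> {a, b} \<notin> E" by simp
  then show ?thesis
    using assms(3,4) sum num_near_pair[OF assms(4), of "- E"] unfolding gain_def H_def
    by (simp add: Let_def del: Int_insert_left)
qed

text \<open>Here \<open>k\<close> will count the neighbours inside \<open>H\<close> and
  \<open>j\<close> the other vertices of \<open>H\<close>. With \<open>k + j\<close> fixed, each
  further neighbour halves \<open>2 ^ j\<close> but costs only a linear amount, so small
  \<open>k\<close> is the critical range. The first bound is tight at \<open>k = 1\<close>, the
  third at \<open>k = 2\<close>, the second at \<open>k = 2\<close>, \<open>j = 0\<close>.\<close>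

lemma power_plus_linear:
  fixes k j :: nat
  shows "1 \<le> k \<Longrightarrow> 2 * (2 ^ j + k) \<le> 2 ^ (k + j) + 2"
    and "1 \<le> k \<Longrightarrow> 2 * (2 ^ j + 2 * k) \<le> 2 ^ (k + j) + 6"
    and "2 \<le> k \<Longrightarrow> 4 * (2 ^ j + k) \<le> 2 ^ (k + j) + 8"
proof -
  have step: "2 ^ (n + j) + 4 \<le> (2 :: nat) ^ (Suc n + j)" if "2 \<le> n" for n
  proof -
    have "(2 :: nat) ^ 2 \<le> 2 ^ (n + j)" using that by (intro power_increasing) auto
    then show ?thesis by simp
  qed
  have two: "2 * (2 ^ j + k) \<le> 2 ^ (k + j) + 2 \<and> 2 * (2 ^ j + 2 * k) \<le> 2 ^ (k + j) + 6
      \<and> 4 * (2 ^ j + k) \<le> 2 ^ (k + j) + 8" if "2 \<le> k" for k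
    using that
  proof (induction k rule: nat_induct_at_least)
    case base
    have "(2 :: nat) ^ j \<ge> 1" by simp
    then show ?case by simp
  next
    case (Suc k)
    then show ?case using step[of k] by simp
  qed
  show "1 \<le> k \<Longrightarrow> 2 * (2 ^ j + k) \<le> 2 ^ (k + j) + 2"
    and "1 \<le> k \<Longrightarrow> 2 * (2 ^ j + 2 * k) \<le> 2 ^ (k + j) + 6"
    and "2 \<le> k \<Longrightarrow> 4 * (2 ^ j + k) \<le> 2 ^ (k + j) + 8"
    using two[of k] by (cases "k = 1"; simp)+
qed

lemma num_indep_diff_power:
  assumes "finite H"
  obtains j where "card H = card (H \<inter> A) + j" "num_indep E (H - A) \<le> 2 ^ j"
proof -
  have "card (H \<inter> A) \<le> card H" using assms by (intro card_mono) auto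
  then show thesis using that[of "card H - card (H \<inter> A)"] num_indep_diff_le[OF assms, of E A] by simp
qed

lemma gain_two_less:
  assumes "finite V" "v \<in> V" "card (nbh E V v) = 2" "card V \<ge> 6"
    and iso: "\<And>x. x \<in> V \<Longrightarrow> nbh E V x \<noteq> {}"
  shows "64 * gain E V v < 27 * 2 ^ (card V - 1) + 64 * (card V - 1)"
proof -
  \<comment> \<open>Since \<open>a\<close> and \<open>b\<close> are interchangeable,
    \<open>b\<close> may be assumed to have neighbours in \<open>H\<close> only if \<open>a\<close>
    has some; this is \<open>kle\<close>.\<close>
  have main: ?thesis if ab: "nbh E V v = {a, b}" "a \<noteq> b"
    and kle: "card ((V - {v, a, b}) \<inter> nbh E V b) > 0 \<Longrightarrow> card ((V - {v, a, b}) \<inter> nbh E V a) > 0" for a b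
  proof -
    define H where "H = V - {v, a, b}"
    define k l where "k = card (H \<inter> nbh E V a)" and "l = card (H \<inter> nbh E V b)"
    define p q x where "p = num_indep E (H - nbh E V a)" and "q = num_indep E (H - nbh E V b)"
      and "x = num_near E H"
    define c where "c = (if {a, b} \<in> E then card (H \<inter> nbh E V a \<inter> nbh E V b) else 1)"
    have fin: "finite H" using assms(1) by (simp add: H_def)
    have gain: "gain E V v = x + p + q + (card H + k + l + c)"
      using gain_two[OF assms(1,2) ab] unfolding H_def k_def l_def p_def q_def x_def c_def .
    have "V - insert v (nbh E V v) = H" by (simp add: H_def ab)
    then have cV: "card V = card H + 3"
      using card_vertex_split(1)[OF assms(1,2), of E] assms(3) by simp
    define M :: nat where "M = 2 ^ card H"
    have "(2 :: nat) ^ 3 \<le> 2 ^ card H" using cV assms(4) by (intro power_increasing) auto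
    then have M8: "M \<ge> 8" by (simp add: M_def)
    have goal: ?thesis if "64 * gain E V v < 108 * M + 64 * card H + 128"
      using that cV by (simp add: M_def power_add)
    have x: "64 * x \<le> 27 * M" unfolding x_def M_def by (rule num_near_bound[OF fin])
    have xi: "num_indep E H + x \<le> M" unfolding x_def M_def by (rule num_indep_add_near_le[OF fin])
    have pq: "p \<le> num_indep E H" "q \<le> num_indep E H"
      unfolding p_def q_def using fin by (auto intro: num_indep_mono)
    obtain j where j: "card H = k + j" "p \<le> 2 ^ j"
      unfolding k_def p_def using num_indep_diff_power[OF fin] by metis
    obtain i where i: "card H = l + i" "q \<le> 2 ^ i"
      unfolding l_def q_def using num_indep_diff_power[OF fin] by metis
    have "card (H \<inter> nbh E V a \<inter> nbh E V b) \<le> k" "card (H \<inter> nbh E V a \<inter> nbh E V b) \<le> l"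
      unfolding k_def l_def using fin by (auto intro!: card_mono)
    then have ck: "c \<le> max 1 k" "c \<le> max 1 l"
      by (auto simp: c_def)
    show ?thesis
    proof (cases "k = 0")
      case True
      then have l: "l = 0" using kle unfolding k_def l_def H_def by auto
      have "nbh E H w \<noteq> {}" if "w \<in> H" for w
      proof -
        have "H \<inter> nbh E V a = {}" "H \<inter> nbh E V b = {}"
          using True l fin unfolding k_def l_def by simp_all
        then show ?thesis
          using nbh_rest_nonempty[of E V w v] iso[of w] that ab by (auto simp: H_def)
      qed
      then have "8 * num_indep E H \<le> 5 * M"
        unfolding M_def using fin cV assms(4) by (intro num_indep_no_isolated) auto
      then have "8 * (x + p + q) \<le> 13 * M" using pq xi by simp
      then show ?thesis using ck True l M8 by (intro goal) (simp add: gain)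
    next
      case False
      then have k1: "2 * (p + k) \<le> M + 2" "2 * (p + 2 * k) \<le> M + 6"
        using power_plus_linear(1,2)[of k j] j unfolding M_def by simp_all
      show ?thesis
      proof (cases "l = 0")
        case True
        then show ?thesis using k1 xi pq ck M8 by (intro goal) (simp add: gain)
      next
        case l: False
        then have "2 * (q + l) \<le> M + 2"
          using power_plus_linear(1)[of l i] i unfolding M_def by simp
        \<comment> \<open>The common neighbours are charged to \<open>a\<close>, so \<open>k\<close>
          is paid twice; the bound on \<open>p + 2 * k\<close> was prepared for this.\<close>
        moreover have "c \<le> k" using ck(1) False by simp
        ultimately show ?thesis using k1 x M8 by (intro goal) (simp add: gain)
      qed
    qed
  qed
  obtain a b where ab: "nbh E V v = {a, b}" "a \<noteq> b" using assms(3) by (auto simp: card_2_iff)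
  have "V - {v, b, a} = V - {v, a, b}" by auto
  then show ?thesis
    using main[OF ab] main[of b a] ab
    by (cases "card ((V - {v, a, b}) \<inter> nbh E V a) > 0") (auto simp: insert_commute)
qed

text \<open>Besides \<open>v\<close>, the vertex \<open>u\<close> has at least two neighbours, so at
  most a quarter of the subsets of \<open>H\<close> remain for the independent sets, and 27/64 +
  16/64 is below the available 54/64. With one neighbour in \<open>H\<close> the same estimate would
  give 59/64.\<close>

lemma gain_pendant_less:
  assumes "finite V" "v \<in> V" "nbh E V v = {u}" "card (nbh E V u) \<ge> 3" "card V \<ge> 6"
  shows "64 * gain E V v < 27 * 2 ^ (card V - 1) + 64 * (card V - 1)"
proof -
  define H where "H = V - {v, u}"
  define k where "k = card (H \<inter> nbh E V u)"
  have fin: "finite H" using assms(1) by (simp add: H_def)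
  have uV: "u \<in> V" using assms(3) nbh_subset by fastforce
  then have vu: "v \<in> nbh E V u" using assms(3) by (intro nbh_sym[OF _ assms(2)]) simp
  have "H \<inter> nbh E V u = nbh E V u - {v}"
    by (auto simp: H_def nbh_def)
  then have k: "k \<ge> 2" using vu assms(1,4) by (simp add: k_def)
  have "V - insert v (nbh E V v) = H" by (simp add: H_def assms(3))
  then have cV: "card V = card H + 2"
    using card_vertex_split(1)[OF assms(1,2), of E] assms(3) by simp
  obtain j where j: "card H = k + j" "num_indep E (H - nbh E V u) \<le> 2 ^ j"
    unfolding k_def using num_indep_diff_power[OF fin] by metis
  define M :: nat where "M = 2 ^ card H"
  have "(2 :: nat) ^ 3 \<le> 2 ^ card H" using cV assms(5) by (intro power_increasing) auto
  then have M8: "M \<ge> 8" by (simp add: M_def)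
  have "64 * num_near E H \<le> 27 * M" unfolding M_def by (rule num_near_bound[OF fin])
  moreover have "4 * (num_indep E (H - nbh E V u) + k) \<le> M + 8"
    using power_plus_linear(3)[OF k, of j] j unfolding M_def by simp
  moreover have "gain E V v = num_near E H + num_indep E (H - nbh E V u) + (card H + k)"
    using gain_pendant[OF assms(1-3)] unfolding H_def k_def .
  ultimately have "64 * gain E V v < 54 * M + 64 * card H + 64" using M8 by simp
  then show ?thesis using cV by (simp add: M_def)
qed

text \<open>Convexity of the powers of two: \<open>2 ^ j\<close> lies below the chord through the
  points at 0 and \<open>m\<close>, cleared of denominators.\<close>

lemma secant_le: "m * 2 ^ j + j \<le> j * 2 ^ m + m" if "j \<le> m" for j m :: nat
  using that
proof (induction m rule: dec_induct)
  case (step m)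
  have "2 ^ j \<le> j * 2 ^ m + 1"
  proof (cases j)
    case (Suc i)
    have "(2 :: nat) ^ j \<le> 2 ^ m" using step by (intro power_increasing) auto
    then show ?thesis using Suc by simp
  qed simp
  moreover have "Suc m * 2 ^ j = m * 2 ^ j + 2 ^ j" "j * 2 ^ Suc m = j * 2 ^ m + j * 2 ^ m" by simp_all
  ultimately show ?case using step.IH by linarith
qed simp

lemma num_near_edgeless:
  assumes "\<And>u. u \<in> V \<Longrightarrow> nbh E V u = {}"
  shows "num_near E V = 0"
proof -
  have False if S: "S \<subseteq> V" "num_edges E S = 1" for S
  proof -
    obtain e where e: "e \<in> all_pairs S \<inter> E"
      using S(2) by (auto simp: num_edges_def card_1_singleton_iff)
    then obtain a b where ab: "e = {a, b}" "a \<noteq> b" by (auto simp: all_pairs_def card_2_iff)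
    with e S(1) have "a \<in> nbh E V b" by (auto simp: nbh_def pair_in_all_pairs)
    moreover have "b \<in> V" using e ab S(1) by (auto simp: all_pairs_def)
    ultimately show False using assms by auto
  qed
  then have "{S. S \<subseteq> V \<and> num_edges E S = 1} = {}" by blast
  then show ?thesis unfolding num_near_def by (simp only: card.empty)
qed

text \<open>If \<open>H\<close> contains an edge, the cap drops by enough to absorb \<open>num_near E H\<close>.\<close>

definition indep_cap :: "'a set set \<Rightarrow> 'a set \<Rightarrow> real" where
  "indep_cap E H = (if \<exists>u\<in>H. nbh E H u \<noteq> {} then 3 / 4 * 2 ^ card H else 2 ^ card H)"

text \<open>An edge in \<open>H\<close> lowers the left summand by \<open>d / 4\<close>, hence by at
  least 3/4 of \<open>2 ^ card H\<close>, while \<open>num_near\<close> takes at most 27/64 of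
  it.\<close>

lemma indep_cap_add_near:
  assumes "finite H" "d \<ge> 3"
  shows "real d * indep_cap E H + real (num_near E H) \<le> real d * 2 ^ card H"
proof (cases "\<exists>u\<in>H. nbh E H u \<noteq> {}")
  case True
  have "64 * real (num_near E H) \<le> 27 * 2 ^ card H"
    using num_near_bound[OF assms(1), of E] of_nat_mono by fastforce
  moreover have "real d * 2 ^ card H \<ge> 3 * 2 ^ card H" using assms(2) by simp
  moreover have "real d * indep_cap E H = 3 / 4 * (real d * 2 ^ card H)"
    using True by (simp add: indep_cap_def)
  ultimately show ?thesis by linarith
next
  case False
  then show ?thesis by (simp add: indep_cap_def num_near_edgeless)
qed

text \<open>The number of independent sets avoiding \<open>A\<close> is convex in the size of \<open>H \<inter> A\<close>, so it lies
  below the chord between the two extreme sizes.\<close>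

lemma num_indep_diff_chord:
  fixes A H :: "'a set"
  assumes fin: "finite H" and m: "card H \<ge> 3"
  defines "m \<equiv> real (card H)" and "k \<equiv> real (card (H \<inter> A))"
  shows "m * real (num_indep E (H - A)) \<le> (m - k) * indep_cap E H + k"
proof -
  obtain j where j: "card H = card (H \<inter> A) + j" "num_indep E (H - A) \<le> 2 ^ j"
    using num_indep_diff_power[OF fin] by metis
  then have jm: "m - k = real j" "j \<le> card H" by (simp_all add: m_def k_def)
  have I: "real (num_indep E (H - A)) \<le> 2 ^ j" using j(2) of_nat_mono by fastforce
  have secant: "real n * 2 ^ j + real j \<le> real j * 2 ^ n + real n" if "j \<le> n" for n
  proof -
    have "real (n * 2 ^ j + j) \<le> real (j * 2 ^ n + n)" using secant_le[OF that] by (rule of_nat_mono)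
    then show ?thesis by simp
  qed
  show ?thesis
  proof (cases "\<exists>u\<in>H. nbh E H u \<noteq> {}")
    case False
    have "m * real (num_indep E (H - A)) \<le> m * 2 ^ j" using I by (simp add: m_def mult_left_mono)
    also have "\<dots> \<le> real j * 2 ^ card H + k"
      using secant[OF jm(2)] jm(1) by (simp add: m_def k_def)
    finally show ?thesis using False jm(1) by (simp add: indep_cap_def)
  next
    case True
    show ?thesis
    proof (cases "j = card H")
      case j0: True
      then have "H \<inter> A = {}" using j(1) fin by simp
      then have HA: "H - A = H" by auto
      obtain u where "u \<in> H" "nbh E H u \<noteq> {}" using True by blast
      then have "4 * num_indep E H \<le> 3 * 2 ^ card H" by (rule num_indep_edge[OF fin])
      then have "4 * real (num_indep E H) \<le> 3 * 2 ^ card H" using of_nat_mono by fastforce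
      then have "m * (4 * real (num_indep E H)) \<le> m * (3 * 2 ^ card H)" by (simp add: m_def mult_left_mono)
      then show ?thesis using True jm(1) j0 HA \<open>H \<inter> A = {}\<close> by (simp add: indep_cap_def m_def k_def)
    next
      case False
      \<comment> \<open>Now \<open>A\<close> meets \<open>H\<close>, so convexity may be used on the
        shorter range up to \<open>n = card H - 1\<close>. The cap equals
        \<open>3 / 2 * 2 ^ n\<close>, and the factor 3/2 pays for stretching the range to
        \<open>n + 1\<close>, since \<open>4 * (n + 1) \<le> 6 * n\<close> from \<open>n = 2\<close>
        on.\<close>
      then obtain n where n: "card H = Suc n" "j \<le> n" "n \<ge> 2" using jm(2) m by (cases "card H") auto
      define P Q :: real where "P = 2 ^ j" and "Q = 2 ^ n"
      have s: "real n * (P - 1) \<le> real j * (Q - 1)"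
        using secant[OF n(2)] by (simp add: P_def Q_def algebra_simps)
      have P1: "P - 1 \<ge> 0" by (simp add: P_def)
      have "4 * (real n + 1) * (P - 1) \<le> 6 * real n * (P - 1)"
        using P1 n(3) by (intro mult_right_mono) auto
      also have "\<dots> \<le> 6 * (real j * (Q - 1))" using s by simp
      finally have "4 * (real n + 1) * P \<le> 4 * (real n + 1) + 6 * real j * Q - 6 * real j"
        by (simp add: algebra_simps)
      then have "4 * ((real n + 1) * P) \<le> 4 * (real j * (3 / 2 * Q) + (real n + 1 - real j))"
        by (simp add: algebra_simps)
      moreover have eqs: "m = real n + 1" "k = real n + 1 - real j" "indep_cap E H = 3 / 2 * Q"
        using True n jm(1) by (simp_all add: m_def indep_cap_def Q_def)
      ultimately have "4 * (m * P) \<le> 4 * (real j * indep_cap E H + k)"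
        by (simp only: eqs)
      moreover have "m * real (num_indep E (H - A)) \<le> m * P"
        using I by (simp add: m_def P_def mult_left_mono)
      ultimately show ?thesis using jm(1) by simp
    qed
  qed
qed

text \<open>The left side bounds the gain at one end of the range of crossing edges:
  \<open>d * 2 ^ h\<close> from one part and the density bound on the other. For
  \<open>d = 2\<close> it already fails at \<open>h = 3\<close>.\<close>

lemma large_degree_arith:
  fixes d h :: nat
  assumes "d \<ge> 3" "h \<ge> 3"
  shows "64 * (d * 2 ^ h) + 27 * 2 ^ d < 27 * 2 ^ (d + h) + 64 * d"
  using assms(2)
proof (induction h rule: nat_induct_at_least)
  case base
  have "448 * d < 189 * 2 ^ d"
    using assms(1) by (induction d rule: nat_induct_at_least) auto
  then show ?case by (simp add: power_add)
next
  case (Suc h)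
  then show ?case using mult_le_power_two[OF assms(1)] by simp
qed

lemma gain_large_less:
  assumes "finite V" "v \<in> V" "card (nbh E V v) \<ge> 3" "card (nbh E V v) + 4 \<le> card V"
  shows "64 * gain E V v < 27 * 2 ^ (card V - 1) + 64 * (card V - 1)"
proof -
  define N where "N = nbh E V v"
  define H where "H = V - insert v N"
  define d h where "d = card N" and "h = card H"
  have fin: "finite N" "finite H" using assms(1) by (simp_all add: N_def H_def)
  have cV: "card V = Suc (d + h)"
    using card_vertex_split(1)[OF assms(1,2), of E] unfolding d_def h_def N_def H_def .
  have d3: "d \<ge> 3" "h \<ge> 3" using assms(3,4) cV by (simp_all add: d_def N_def)
  define k l where "k u = card (H \<inter> nbh E V u)" and "l w = card (N \<inter> nbh E V w)" for u w
  define K where "K = (\<Sum>u\<in>N. real (k u))"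
  define a b where "a = indep_cap E H" and "b = indep_cap (- E) N"
  \<comment> \<open>Double counting of the edges between \<open>N\<close> and
    \<open>H\<close>.\<close>
  have KL: "K = (\<Sum>w\<in>H. real (l w))"
  proof -
    have sym: "w \<in> nbh E V u \<longleftrightarrow> u \<in> nbh E V w" if "u \<in> N" "w \<in> H" for u w
      using that nbh_sym[of u E V w] nbh_sym[of w E V u] nbh_subset[of E V v] by (auto simp: N_def H_def)
    have "K = (\<Sum>u\<in>N. \<Sum>w\<in>H. of_bool (w \<in> nbh E V u))"
      using fin by (simp add: K_def k_def sum_of_bool_eq Int_def)
    also have "\<dots> = (\<Sum>w\<in>H. \<Sum>u\<in>N. of_bool (w \<in> nbh E V u))" by (rule sum.swap)
    also have "\<dots> = (\<Sum>w\<in>H. \<Sum>u\<in>N. of_bool (u \<in> nbh E V w))"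
      using sym by (intro sum.cong refl arg_cong[where f = of_bool]) blast
    also have "\<dots> = (\<Sum>w\<in>H. real (l w))"
      using fin by (simp add: l_def sum_of_bool_eq Int_def)
    finally show ?thesis .
  qed
  have "K \<le> (\<Sum>u\<in>N. real h)"
    unfolding K_def k_def h_def using fin by (intro sum_mono of_nat_mono card_mono) auto
  then have K: "0 \<le> K" "K \<le> real d * real h" by (simp_all add: K_def d_def sum_nonneg)
  have S: "real h * (\<Sum>u\<in>N. real (num_indep E (H - nbh E V u))) \<le> real d * real h * a - K * (a - 1)"
  proof -
    have "real h * (\<Sum>u\<in>N. real (num_indep E (H - nbh E V u)))
        \<le> (\<Sum>u\<in>N. (real h - real (k u)) * a + real (k u))"
      unfolding sum_distrib_left a_def h_def k_def using fin d3
      by (intro sum_mono num_indep_diff_chord) (auto simp: h_def)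
    also have "\<dots> = real d * real h * a - K * (a - 1)"
      by (simp add: K_def d_def sum.distrib sum_subtractf algebra_simps sum_distrib_left)
    finally show ?thesis .
  qed
  have T: "real d * (\<Sum>w\<in>H. real (num_indep (- E) (N \<inter> nbh E V w))) \<le> real d * real h + K * (b - 1)"
  proof -
    have "real d * real (num_indep (- E) (N \<inter> nbh E V w)) \<le> real (l w) * b + (real d - real (l w))" for w
    proof -
      \<comment> \<open>In the complement it is the non-neighbours of \<open>w\<close> that are
        avoided, so crossing edges increase this sum while they decrease the other one.\<close>
      have "N - (N - nbh E V w) = N \<inter> nbh E V w" "N \<inter> (N - nbh E V w) = N - nbh E V w" by auto
      moreover have "real (card (N - nbh E V w)) = real d - real (l w)"
        using fin card_mono[of N "N \<inter> nbh E V w"]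
        by (simp add: d_def l_def card_Diff_subset_Int of_nat_diff)
      ultimately show ?thesis
        using num_indep_diff_chord[where H = N and A = "N - nbh E V w" and E = "- E"] fin d3 by (simp add: b_def d_def)
    qed
    then have "real d * (\<Sum>w\<in>H. real (num_indep (- E) (N \<inter> nbh E V w)))
        \<le> (\<Sum>w\<in>H. real (l w) * b + (real d - real (l w)))"
      unfolding sum_distrib_left by (intro sum_mono)
    also have "\<dots> = real d * real h + K * (b - 1)"
      by (simp add: KL h_def sum.distrib sum_subtractf algebra_simps sum_distrib_left)
    finally show ?thesis .
  qed
  define x y where "x = real (num_near E H)" and "y = real (num_near (- E) N)"
  define s t where "s = (\<Sum>u\<in>N. real (num_indep E (H - nbh E V u)))"
    and "t = (\<Sum>w\<in>H. real (num_indep (- E) (N \<inter> nbh E V w)))"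
  have gain: "real (gain E V v) = x + y + s + t"
    unfolding gain_def Let_def N_def[symmetric] H_def[symmetric] x_def y_def s_def t_def by simp
  have xa: "real d * a + x \<le> real d * 2 ^ h" and yb: "real h * b + y \<le> real h * 2 ^ d"
    unfolding a_def b_def x_def y_def h_def d_def
    using indep_cap_add_near[OF fin(2), of d E] indep_cap_add_near[OF fin(1), of h "- E"] d3
    by (simp_all add: h_def d_def)
  have x: "64 * x \<le> 27 * 2 ^ h" and y: "64 * y \<le> 27 * 2 ^ d"
    unfolding x_def y_def h_def d_def
    using of_nat_mono[OF num_near_bound[OF fin(2), of E], where 'a = real]
      of_nat_mono[OF num_near_bound[OF fin(1), of "- E"], where 'a = real] by simp_all
  have dh: "real d * real h > 0" using d3 by simp
  txt \<open>The bound is linear in \<open>K\<close>, so it is attained at \<open>K = 0\<close> or \<open>K = d * h\<close>.\<close>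
  have "real d * real h * (s + t) \<le> real d * real h * (real d * a + real h) + K * (real h * (b - 1) - real d * (a - 1))"
  proof -
    have "real d * (real h * s) \<le> real d * (real d * real h * a - K * (a - 1))"
      using S by (intro mult_left_mono) (simp_all add: s_def)
    moreover have "real h * (real d * t) \<le> real h * (real d * real h + K * (b - 1))"
      using T by (intro mult_left_mono) (simp_all add: t_def)
    ultimately show ?thesis by (simp add: algebra_simps)
  qed
  also have "\<dots> \<le> real d * real h * (real d * a + real h) + real d * real h * max 0 (real h * (b - 1) - real d * (a - 1))"
  proof -
    have "K * (real h * (b - 1) - real d * (a - 1)) \<le> K * max 0 (real h * (b - 1) - real d * (a - 1))"
      using K by (intro mult_left_mono) auto
    also have "\<dots> \<le> real d * real h * max 0 (real h * (b - 1) - real d * (a - 1))"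
      using K by (intro mult_right_mono) auto
    finally show ?thesis by simp
  qed
  finally have "real d * real h * (s + t)
      \<le> real d * real h * (real d * a + real h + max 0 (real h * (b - 1) - real d * (a - 1)))"
    by (simp add: algebra_simps)
  then have "s + t \<le> real d * a + real h + max 0 (real h * (b - 1) - real d * (a - 1))"
    using dh by (simp only: mult_le_cancel_left_pos)
  \<comment> \<open>The alternatives are the values at \<open>K = 0\<close> and
    \<open>K = d * h\<close>. In the first, \<open>x\<close> is absorbed by the cap \<open>a\<close>
    and \<open>y\<close> is left to the density bound; in the second, the roles are
    exchanged.\<close>
  then have st: "s + t \<le> real d * a + real h \<or> s + t \<le> real h * b + real d"
    by (simp add: max_def algebra_simps split: if_splits)
  have "64 * (real d * 2 ^ h) + 27 * 2 ^ d < 27 * 2 ^ (d + h) + 64 * real d"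
  proof -
    have "real (64 * (d * 2 ^ h) + 27 * 2 ^ d) < real (27 * 2 ^ (d + h) + 64 * d)"
      using large_degree_arith[OF d3] by (simp only: of_nat_less_iff)
    then show ?thesis by simp
  qed
  moreover have "64 * (real h * 2 ^ d) + 27 * 2 ^ h < 27 * 2 ^ (d + h) + 64 * real h"
  proof -
    have "real (64 * (h * 2 ^ d) + 27 * 2 ^ h) < real (27 * 2 ^ (h + d) + 64 * h)"
      using large_degree_arith[OF d3(2,1)] by (simp only: of_nat_less_iff)
    then show ?thesis by (simp add: add.commute)
  qed
  ultimately have "64 * real (gain E V v) < 27 * 2 ^ (d + h) + 64 * (real d + real h)"
    using st
  proof (elim disjE)
    assume "s + t \<le> real d * a + real h"
    moreover assume "64 * (real d * 2 ^ h) + 27 * 2 ^ d < 27 * 2 ^ (d + h) + 64 * real d"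
    ultimately show ?thesis using xa y gain by argo
  next
    assume "s + t \<le> real h * b + real d"
    moreover assume "64 * (real h * 2 ^ d) + 27 * 2 ^ h < 27 * 2 ^ (d + h) + 64 * real h"
    ultimately show ?thesis using yb x gain by argo
  qed
  then have "real (64 * gain E V v) < real (27 * 2 ^ (d + h) + 64 * (d + h))" by simp
  then show ?thesis unfolding cV of_nat_less_iff by simp
qed

section \<open>Graphs of order five\<close>

lemma degree_compl:
  assumes "finite V" "v \<in> V"
  shows "card (nbh E V v) + card (nbh (- E) V v) = card V - 1"
  using card_vertex_split(1)[OF assms, of E] nbh_compl_remove(1)[OF assms(2), of E] by simp

lemma near_total_pair: "a \<noteq> b \<Longrightarrow> near_total E {a, b} = 1"
  by (simp add: near_total_def num_near_pair)

text \<open>The degrees of \<open>v\<close> in the graph and in the complement sum to 2, so one of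
  them is at most 1, and \<open>gain\<close> does not distinguish the two graphs. The same works at
  order four, where the sum is 3.\<close>

lemma gain_three:
  assumes "finite V" "v \<in> V" "card V = 3"
  shows "gain E V v \<le> 3"
proof -
  have main: "gain E V v \<le> 3" if "card (nbh E V v) \<le> 1" for E
  proof (cases "card (nbh E V v) = 0")
    case True
    have "64 * num_near E (V - {v}) \<le> 27 * 2 ^ 2"
      using num_near_bound[of "V - {v}" E] assms by simp
    then show ?thesis using True assms gain_isolated[OF assms(1,2), of E] by simp
  next
    case False
    then obtain u where u: "nbh E V v = {u}" using \<open>card (nbh E V v) \<le> 1\<close>
      by (metis card_1_singletonE le_antisym less_one not_le)
    define H where "H = V - {v, u}"
    have "card H = 1"
      using card_vertex_split(1)[OF assms(1,2), of E] assms(3) u by (simp add: H_def)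
    then obtain w where w: "H = {w}" by (auto simp: card_1_singleton_iff)
    have "gain E V v = num_near E H + num_indep E (H - nbh E V u) + (card H + card (H \<inter> nbh E V u))"
      using gain_pendant[OF assms(1,2) u] unfolding H_def .
    then show ?thesis unfolding w by (cases "w \<in> nbh E V u") (auto simp: insert_Diff_if)
  qed
  have "card (nbh E V v) \<le> 1 \<or> card (nbh (- E) V v) \<le> 1"
    using degree_compl[OF assms(1,2), of E] assms(3) by auto
  then show ?thesis using main[of E] main[of "- E"] gain_compl[OF assms(1,2), of E] by auto
qed

lemma gain_four:
  assumes "finite V" "v \<in> V" "card V = 4"
  shows "gain E V v \<le> 6"
proof -
  have main: "gain E V v \<le> 6" if le1: "card (nbh E V v) \<le> 1" for E
  proof (cases "card (nbh E V v) = 0")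
    case True
    have "64 * num_near E (V - {v}) \<le> 27 * 2 ^ 3"
      using num_near_bound[of "V - {v}" E] assms by simp
    then show ?thesis using True assms gain_isolated[OF assms(1,2), of E] by simp
  next
    case False
    then have "card (nbh E V v) = 1" using le1 by simp
    then obtain u where u: "nbh E V v = {u}" by (auto simp: card_1_singleton_iff)
    define H k where "H = V - {v, u}" and "k = card (H \<inter> nbh E V u)"
    have H: "card H = 2" "finite H"
      using card_vertex_split(1)[OF assms(1,2), of E] assms(1,3) u by (simp_all add: H_def)
    have gain: "gain E V v = num_near E H + num_indep E (H - nbh E V u) + (card H + k)"
      using gain_pendant[OF assms(1,2) u] unfolding H_def k_def .
    have near: "64 * num_near E H \<le> 27 * 2 ^ 2" using num_near_bound[OF H(2), of E] H(1) by simp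
    have sum: "num_indep E H + num_near E H \<le> 2 ^ 2" using num_indep_add_near_le[OF H(2), of E] H(1) by simp
    have le: "num_indep E (H - nbh E V u) \<le> num_indep E H"
      using H by (intro num_indep_mono) auto
    have ind: "num_indep E (H - nbh E V u) \<le> 2 ^ (2 - k)"
      using num_indep_diff_le[OF H(2), of E "nbh E V u"] H(1) by (simp add: k_def)
    have "k \<le> 2" using card_mono[of H "H \<inter> nbh E V u"] H by (simp add: k_def)
    then consider "k = 0" | "k = 1" | "k = 2" by linarith
    then show ?thesis using near sum le ind gain H(1) by cases auto
  qed
  have "card (nbh E V v) \<le> 1 \<or> card (nbh (- E) V v) \<le> 1"
    using degree_compl[OF assms(1,2), of E] assms(3) by auto
  then show ?thesis using main[of E] main[of "- E"] gain_compl[OF assms(1,2), of E] by auto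
qed

lemma gain_five_two:
  assumes "finite V" "v \<in> V" "card V = 5" "card (nbh E V v) = 2"
    and iso: "\<And>x. x \<in> V \<Longrightarrow> nbh E V x \<noteq> {}" and full: "\<And>x. x \<in> V \<Longrightarrow> nbh (- E) V x \<noteq> {}"
  shows "gain E V v \<le> 10"
proof -
  have main: "gain E V v \<le> 10" if ab: "nbh E V v = {a, b}" "a \<noteq> b"
    and kle: "card ((V - {v, a, b}) \<inter> nbh E V b) > 0 \<Longrightarrow> card ((V - {v, a, b}) \<inter> nbh E V a) > 0" for a b
  proof -
    define H where "H = V - {v, a, b}"
    define k l where "k = card (H \<inter> nbh E V a)" and "l = card (H \<inter> nbh E V b)"
    define p q x where "p = num_indep E (H - nbh E V a)" and "q = num_indep E (H - nbh E V b)"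
      and "x = num_near E H"
    define c where "c = (if {a, b} \<in> E then card (H \<inter> nbh E V a \<inter> nbh E V b) else 1)"
    have "V - insert v (nbh E V v) = H" by (simp add: H_def ab)
    then have H: "card H = 2" "finite H"
      using card_vertex_split(1)[OF assms(1,2), of E] assms by (simp_all add: H_def)
    have gain: "gain E V v = x + p + q + (card H + k + l + c)"
      using gain_two[OF assms(1,2) ab] unfolding H_def k_def l_def p_def q_def x_def c_def .
    have x: "64 * x \<le> 27 * 2 ^ 2" unfolding x_def using num_near_bound[OF H(2), of E] H(1) by simp
    have xi: "num_indep E H + x \<le> 2 ^ 2" unfolding x_def using num_indep_add_near_le[OF H(2), of E] H(1) by simp
    have pq: "p \<le> num_indep E H" "q \<le> num_indep E H"
      unfolding p_def q_def using H by (auto intro: num_indep_mono)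
    have pk: "p \<le> 2 ^ (2 - k)" "q \<le> 2 ^ (2 - l)"
      unfolding p_def q_def k_def l_def
      using num_indep_diff_le[OF H(2), of E "nbh E V a"] num_indep_diff_le[OF H(2), of E "nbh E V b"] H(1)
      by simp_all
    have "card (H \<inter> nbh E V a) \<le> card H" "card (H \<inter> nbh E V b) \<le> card H"
      using H(2) by (auto intro!: card_mono)
    then have kl2: "k \<in> {0, 1, 2}" "l \<in> {0, 1, 2}" using H(1) unfolding k_def l_def by auto
    have "card (H \<inter> nbh E V a \<inter> nbh E V b) \<le> k" "card (H \<inter> nbh E V a \<inter> nbh E V b) \<le> l"
      unfolding k_def l_def using H(2) by (auto intro!: card_mono)
    then have cl: "c \<le> max 1 l" "{a, b} \<in> E \<Longrightarrow> c \<le> k" "{a, b} \<notin> E \<Longrightarrow> c = 1"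
      by (auto simp: c_def)
    show ?thesis
    proof (cases "k = 0")
      case True
      then have l: "l = 0" using kle unfolding k_def l_def H_def by auto
      obtain w where w: "w \<in> H" using H(1) by fastforce
      have "H \<inter> nbh E V a = {}" "H \<inter> nbh E V b = {}"
        using True l H(2) unfolding k_def l_def by simp_all
      then have "nbh E H w \<noteq> {}"
        using nbh_rest_nonempty[of E V w v] iso[of w] w ab by (auto simp: H_def)
      then have "4 * num_indep E H \<le> 12" using num_indep_edge[OF H(2) w] H(1) by simp
      then show ?thesis using True l gain H(1) xi pq cl(1) by simp
    next
      case k: False
      show ?thesis
      proof (cases "l = 0")
        case True
        then show ?thesis using k kl2 gain H(1) xi pq pk cl(1) by auto
      next
        case l: False
        \<comment> \<open>Otherwise \<open>a\<close> would be adjacent to \<open>v\<close>,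
          \<open>b\<close> and both vertices of \<open>H\<close>, against \<open>full\<close>. This
          excludes \<open>k = l = c = 2\<close>, for which the estimate would only give 11.\<close>
        have "k \<le> 1" if "{a, b} \<in> E"
        proof (rule ccontr)
          assume "\<not> k \<le> 1"
          then have "H \<inter> nbh E V a = H"
            using kl2 H by (intro card_subset_eq) (auto simp: k_def)
          moreover have aV: "a \<in> V" "b \<in> V" using ab(1) nbh_subset[of E V v] by auto
          moreover have "v \<in> nbh E V a" "b \<in> nbh E V a"
            using aV ab that nbh_sym[of a E V v] assms(2) by (simp_all add: nbh_def insert_commute)
          ultimately have "w \<in> nbh E V a" if "w \<in> V - {a}" for w
            using that unfolding H_def by (cases "w = v \<or> w = b") blast+
          then have "nbh (- E) V a = {}"
            unfolding nbh_compl_remove(1)[OF aV(1)] by blast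
          then show False using full[OF aV(1)] by simp
        qed
        then have "c \<le> 1" using cl(2,3) by (cases "{a, b} \<in> E") auto
        then show ?thesis using k l kl2 gain H(1) x pk by auto
      qed
    qed
  qed
  obtain a b where ab: "nbh E V v = {a, b}" "a \<noteq> b" using assms(4) by (auto simp: card_2_iff)
  have "V - {v, b, a} = V - {v, a, b}" by auto
  then show ?thesis
    using main[OF ab] main[of b a] ab
    by (cases "card ((V - {v, a, b}) \<inter> nbh E V a) > 0") (auto simp: insert_commute)
qed

text \<open>The degree of \<open>u\<close> cannot be 1: the other three vertices would then have
  degree 1 among themselves, impossible for an odd order. So \<open>u\<close> has degree 3 and two
  neighbours in \<open>H\<close>.\<close>

lemma gain_five_pendant:
  assumes "finite V" "v \<in> V" "card V = 5" "card (nbh E V v) = 1"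
    and deg: "\<And>x. x \<in> V \<Longrightarrow> card (nbh E V x) = 1 \<or> card (nbh E V x) = 3"
  shows "gain E V v \<le> 10"
proof -
  obtain u where u: "nbh E V v = {u}" using assms(4) by (auto simp: card_1_singleton_iff)
  define H k where "H = V - {v, u}" and "k = card (H \<inter> nbh E V u)"
  have H: "card H = 3" "finite H"
    using card_vertex_split(1)[OF assms(1,2), of E] assms(1,3) u by (simp_all add: H_def)
  have gain: "gain E V v = num_near E H + num_indep E (H - nbh E V u) + (card H + k)"
    using gain_pendant[OF assms(1,2) u] unfolding H_def k_def .
  have uV: "u \<in> V" using u nbh_subset[of E V v] by auto
  then have vu: "v \<in> nbh E V u" using u by (intro nbh_sym[OF _ assms(2)]) simp
  have Hu: "H \<inter> nbh E V u = nbh E V u - {v}" by (auto simp: H_def nbh_def)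
  then have k: "card (nbh E V u) = Suc k"
    using card_Suc_Diff1[of "nbh E V u" v] vu assms(1) by (simp add: k_def)
  have "k \<noteq> 0"
  proof
    assume "k = 0"
    then have "card (nbh E V u) = 1" using k by simp
    then have u': "nbh E V u = {v}" using vu by (auto simp: card_1_singleton_iff)
    have rest: "nbh E H w = nbh E V w" if "w \<in> H" for w
      using nbh_K2_rest[OF u u'] that by (simp add: H_def)
    have deg1: "card (nbh E H w) = 1" if w: "w \<in> H" for w
    proof -
      have "nbh E H w \<subseteq> H - {w}" by (auto simp: nbh_def)
      then have "card (nbh E H w) \<le> card (H - {w})" using H by (intro card_mono) auto
      then show ?thesis using w H deg[of w] rest[OF w] by (auto simp: H_def)
    qed
    have "\<exists>j. card H = 2 * j"
      using perfect_matching_counts[OF H(2) deg1] by blast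
    with H(1) show False by presburger
  qed
  then have "k = 2" using k deg[OF uV] by auto
  then have "num_indep E (H - nbh E V u) \<le> 2"
    using num_indep_diff_le[OF H(2), of E "nbh E V u"] H(1) by (simp add: k_def)
  moreover have "64 * num_near E H \<le> 27 * 2 ^ 3" using num_near_bound[OF H(2), of E] H(1) by simp
  ultimately show ?thesis using gain H(1) \<open>k = 2\<close> by simp
qed

text \<open>A pair contributes 1, and the gains 3, 6 and 10 lead to 4, 10 and 20. The target 20.5
  leaves room for no larger integer.\<close>

lemma near_total_five:
  assumes "finite V" "card V = 5"
  shows "near_total E V \<le> 20"
proof -
  have rm: "finite (V - {v})" "card (V - {v}) = card V - 1" if "finite V" "v \<in> V" for V :: "'a set" and v
    using that by simp_all
  have three: "near_total E W \<le> 4" if W: "finite W" "card W = 3" for W :: "'a set"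
  proof -
    obtain v where v: "v \<in> W" using W by fastforce
    then have "card (W - {v}) = 2" using W by simp
    then obtain a b where "W - {v} = {a, b}" "a \<noteq> b" by (auto simp: card_2_iff)
    then show ?thesis
      using near_total_remove[OF W(1) v, of E] gain_three[OF W(1) v W(2), of E] by (simp add: near_total_pair)
  qed
  have four: "near_total E W \<le> 10" if W: "finite W" "card W = 4" for W :: "'a set"
  proof -
    obtain v where v: "v \<in> W" using W by fastforce
    have "near_total E (W - {v}) \<le> 4" using three rm[OF W(1) v] W by simp
    then show ?thesis
      using near_total_remove[OF W(1) v, of E] gain_four[OF W(1) v W(2), of E] by simp
  qed
  have reduce: "near_total E V \<le> 20" if v: "v \<in> V" "gain E V v \<le> 10" for v
    using near_total_remove[OF assms(1) v(1), of E] v(2) four[of "V - {v}"] rm[OF assms(1) v(1)] assms by simp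
  have iso: "gain E V v \<le> 10" if "v \<in> V" "nbh E V v = {}" for v E
  proof -
    have "64 * num_near E (V - {v}) \<le> 27 * 2 ^ 4"
      using num_near_bound[of "V - {v}" E] assms that by simp
    then show ?thesis using gain_isolated[OF assms(1) that] assms(2) by simp
  qed
  have deg: "card (nbh E V v) + card (nbh (- E) V v) = 4" if "v \<in> V" for v
    using degree_compl[OF assms(1) that, of E] assms(2) by simp
  have comp: "gain (- E) V v = gain E V v" if "v \<in> V" for v
    using gain_compl[OF assms(1) that] .
  show ?thesis
  proof (cases "\<exists>v\<in>V. nbh E V v = {} \<or> nbh (- E) V v = {}")
    case True
    then show ?thesis using iso comp reduce by metis
  next
    case False
    show ?thesis
    proof (cases "\<exists>v\<in>V. card (nbh E V v) = 2")
      case True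
      then show ?thesis using reduce gain_five_two[OF assms(1) _ assms(2)] False by metis
    next
      case no2: False
      have pos: "card (nbh E V x) > 0" "card (nbh (- E) V x) > 0" if "x \<in> V" for x
        using False that assms(1) by (auto simp: card_gt_0_iff)
      have d1: "card (nbh E V x) = 1 \<or> card (nbh E V x) = 3" if x: "x \<in> V" for x
      proof -
        have "card (nbh E V x) \<noteq> 2" using no2 x by blast
        then show ?thesis using deg[OF x] pos[OF x] by linarith
      qed
      then have d2: "card (nbh (- E) V x) = 1 \<or> card (nbh (- E) V x) = 3" if "x \<in> V" for x
        using deg[OF that] d1[OF that] by auto
      obtain v where v: "v \<in> V" using assms by fastforce
      show ?thesis
        using d1[OF v]
      proof
        assume "card (nbh E V v) = 1"
        then show ?thesis using reduce v gain_five_pendant[OF assms(1) v assms(2) _ d1] by blast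
      next
        assume "card (nbh E V v) = 3"
        then have "card (nbh (- E) V v) = 1" using deg[OF v] by simp
        then show ?thesis using reduce v comp gain_five_pendant[OF assms(1) v assms(2) _ d2] by metis
      qed
    qed
  qed
qed

section \<open>Three disjoint edges\<close>

text \<open>Intersecting with \<open>all_pairs V\<close> makes the notion applicable to
  \<open>- E\<close>, which contains sets other than pairs. Any further vertices are
  isolated.\<close>

definition three_edges :: "'a set set \<Rightarrow> 'a set \<Rightarrow> bool" where
  "three_edges E V \<longleftrightarrow> (\<exists>a b c d e f. distinct [a, b, c, d, e, f] \<and> {a, b, c, d, e, f} \<subseteq> V
     \<and> all_pairs V \<inter> E = {{a, b}, {c, d}, {e, f}})"

lemma edgeless_counts:
  assumes "finite V" "\<And>u. u \<in> V \<Longrightarrow> nbh E V u = {}"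
  shows "num_indep E V = 2 ^ card V \<and> num_near (- E) V = card V choose 2"
  using assms
proof (induction V rule: finite_induct)
  case (insert x V)
  have "nbh E V u = {}" if "u \<in> V" for u
    using insert.prems[of u] that nbh_subset_restrict[of V "insert x V" E u] by auto
  then have IH: "num_indep E V = 2 ^ card V" "num_near (- E) V = card V choose 2"
    using insert.IH by auto
  have x: "nbh E (insert x V) x = {}" "insert x V - {x} = V" using insert by auto
  show ?case
    using num_indep_isolated[of "insert x V" x E] num_near_compl_isolated[of "insert x V" x E] x IH insert.hyps
    by (simp add: numeral_2_eq_2)
qed (simp add: numeral_2_eq_2)

lemma all_pairs_K2:
  assumes "x \<in> V" "nbh E V x = {y}" "nbh E V y = {x}"
  shows "all_pairs V \<inter> E = insert {x, y} (all_pairs (V - {x, y}) \<inter> E)"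
proof (intro equalityI subsetI)
  fix e assume e: "e \<in> all_pairs V \<inter> E"
  then obtain p q where pq: "e = {p, q}" "p \<noteq> q" by (auto simp: all_pairs_def card_2_iff)
  then have nb: "p \<in> nbh E V q" "q \<in> nbh E V p"
    using e by (auto simp: pair_in_all_pairs nbh_def insert_commute)
  show "e \<in> insert {x, y} (all_pairs (V - {x, y}) \<inter> E)"
  proof (cases "p \<in> {x, y} \<or> q \<in> {x, y}")
    case True
    then show ?thesis using nb assms(2,3) pq(1) by auto
  next
    case False
    then show ?thesis using e pq by (auto simp: pair_in_all_pairs)
  qed
next
  have "y \<in> V" "y \<noteq> x" "{y, x} \<in> E" using assms(2) by (auto simp: nbh_def)
  then show "e \<in> all_pairs V \<inter> E" if "e \<in> insert {x, y} (all_pairs (V - {x, y}) \<inter> E)" for e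
    using that assms(1) by (auto simp: pair_in_all_pairs insert_commute all_pairs_def)
qed

lemma Suc_choose_two: "Suc n choose 2 = n + (n choose 2)"
  by (simp add: numeral_2_eq_2)

text \<open>The three edges are peeled off as isolated edges until an edgeless graph
  \<open>C\<close> remains, whose complement contributes just its pairs.\<close>

lemma three_edges_counts:
  assumes "finite V" "three_edges E V"
  shows "64 * num_near E V = 27 * 2 ^ card V" and "num_near (- E) V + 3 = card V choose 2"
proof -
  obtain a b c d e f where dist: "distinct [a, b, c, d, e, f]" and sub: "{a, b, c, d, e, f} \<subseteq> V"
    and E: "all_pairs V \<inter> E = {{a, b}, {c, d}, {e, f}}"
    using assms(2) unfolding three_edges_def by (elim exE conjE) (rule that)
  have mem: "x \<in> nbh E W y \<longleftrightarrow> x \<in> W \<and> {x, y} \<in> {{a, b}, {c, d}, {e, f}}"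
    if "W \<subseteq> V" "y \<in> W" for x y W
  proof -
    have "x \<in> nbh E W y \<longleftrightarrow> x \<in> W \<and> {x, y} \<in> all_pairs V \<inter> E"
      using that by (auto simp: nbh_def pair_in_all_pairs)
    then show ?thesis by (simp add: E)
  qed
  define A where "A = V - {a, b}"
  define B where "B = A - {c, d}"
  define C where "C = B - {e, f}"
  have fin: "finite A" "finite B" "finite C" using assms(1) by (simp_all add: A_def B_def C_def)
  have inV: "a \<in> V" "b \<in> V" "c \<in> A" "d \<in> A" "e \<in> B" "f \<in> B" "A \<subseteq> V" "B \<subseteq> V" "C \<subseteq> V"
    using sub dist by (auto simp: A_def B_def C_def)
  have cards: "card V = card A + 2" "card A = card B + 2" "card B = card C + 2"
    using card_remove_two_eq[of V a b] card_remove_two_eq[of A c d] card_remove_two_eq[of B e f]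
      inV fin assms(1) dist
    unfolding A_def[symmetric] B_def[symmetric] C_def[symmetric] by auto
  have nb: "nbh E W x = {y}"
    if "W \<subseteq> V" "x \<in> W" "y \<in> W" "{z. {z, x} \<in> {{a, b}, {c, d}, {e, f}}} = {y}" for W x y
    using that(3,4) by (auto simp: set_eq_iff mem[OF that(1,2)])
  have a: "nbh E V a = {b}" "nbh E V b = {a}"
    by (rule nb; use inV(1,2) dist in \<open>auto simp: doubleton_eq_iff\<close>)+
  have c: "nbh E A c = {d}" "nbh E A d = {c}"
    by (rule nb; use inV(3,4,7) dist in \<open>auto simp: doubleton_eq_iff\<close>)+
  have e: "nbh E B e = {f}" "nbh E B f = {e}"
    by (rule nb; use inV(5,6,8) dist in \<open>auto simp: doubleton_eq_iff\<close>)+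
  have "nbh E C u = {}" if "u \<in> C" for u
  proof -
    have "u \<notin> {a, b, c, d, e, f}" using that by (auto simp: A_def B_def C_def)
    then show ?thesis by (auto simp: set_eq_iff mem[OF inV(9) that] doubleton_eq_iff)
  qed
  then have C: "num_indep E C = 2 ^ card C" "num_near E C = 0" "num_near (- E) C = card C choose 2"
    using edgeless_counts[OF fin(3), of E] num_near_edgeless[of C E] by auto
  note AA = num_indep_K2 num_near_K2 num_near_compl_K2
  note V = AA(2,3)[OF assms(1) inV(1) a, folded A_def]
  note A = AA[OF fin(1) inV(3) c, folded B_def]
  note B = AA[OF fin(2) inV(5) e, folded C_def]
  show "64 * num_near E V = 27 * 2 ^ card V"
    using V A B C cards by (simp add: power_add)
  show "num_near (- E) V + 3 = card V choose 2"
    using V A B C cards by (simp add: Suc_choose_two)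
qed

lemma three_edges_isolated:
  assumes "x \<in> V" "nbh E V x = {}" "three_edges E (V - {x})"
  shows "three_edges E V"
proof -
  have "all_pairs V = all_pairs (V - {x}) \<union> (\<lambda>u. {u, x}) ` (V - {x})"
    using all_pairs_insert[of x "V - {x}"] assms(1) by (simp add: insert_absorb)
  moreover have "{u, x} \<notin> E" if "u \<in> V - {x}" for u
    using that assms(2) by (auto simp: nbh_def)
  ultimately have "all_pairs V \<inter> E = all_pairs (V - {x}) \<inter> E" by auto
  then show ?thesis using assms(3) unfolding three_edges_def
    by (metis Diff_subset subset_trans)
qed

lemma three_edges_matching:
  assumes "finite V" "card V = 6" "\<And>v. v \<in> V \<Longrightarrow> card (nbh E V v) = 1"
  shows "three_edges E V"
proof -
  obtain a where a: "a \<in> V" using assms(1,2) by fastforce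
  obtain b where b: "b \<in> V" "b \<noteq> a" "nbh E V a = {b}" "nbh E V b = {a}"
    "\<And>w. w \<in> V - {a, b} \<Longrightarrow> card (nbh E (V - {a, b}) w) = 1"
    using matching_partner[OF assms(3) a] by blast
  define A where "A = V - {a, b}"
  have A: "card A = 4" "finite A"
    using card_remove_two_eq[OF assms(1) a b(1,2)] assms(1,2) unfolding A_def by simp_all
  obtain c where c: "c \<in> A" using A by fastforce
  obtain d where d: "d \<in> A" "d \<noteq> c" "nbh E A c = {d}" "nbh E A d = {c}"
    "\<And>w. w \<in> A - {c, d} \<Longrightarrow> card (nbh E (A - {c, d}) w) = 1"
    using matching_partner[OF b(5)[folded A_def] c] by blast
  define B where "B = A - {c, d}"
  have B: "card B = 2" "finite B"
    using card_remove_two_eq[OF A(2) c d(1,2)] A unfolding B_def by simp_all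
  obtain e where e: "e \<in> B" using B by fastforce
  obtain f where f: "f \<in> B" "f \<noteq> e" "nbh E B e = {f}" "nbh E B f = {e}"
    by (rule matching_partner[OF d(5)[folded B_def] e])
  have "card (B - {e, f}) = 0"
    using card_remove_two_eq[OF B(2) e f(1,2)] B by simp
  then have "B - {e, f} = {}" using B(2) by simp
  then have "all_pairs (B - {e, f}) = {}" by (simp only: all_pairs_empty)
  then have "all_pairs V \<inter> E = {{a, b}, {c, d}, {e, f}}"
    using all_pairs_K2[OF a b(3,4)] all_pairs_K2[OF c d(3,4)] all_pairs_K2[OF e f(3,4)]
    unfolding A_def[symmetric] B_def[symmetric] by simp
  moreover have "distinct [a, b, c, d, e, f]" "{a, b, c, d, e, f} \<subseteq> V"
    using a b(1,2) c d(1,2) e f(1,2) by (auto simp: A_def B_def)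
  ultimately have "distinct [a, b, c, d, e, f] \<and> {a, b, c, d, e, f} \<subseteq> V
      \<and> all_pairs V \<inter> E = {{a, b}, {c, d}, {e, f}}"
    by (intro conjI)
  then show ?thesis unfolding three_edges_def by (intro exI)
qed

section \<open>Induction on the order\<close>

text \<open>At order eight, four disjoint edges reach the density 27/64 as well, so the exponential
  part is not strict there; strictness comes from \<open>card H\<close>, which is one less than the
  allowed \<open>card V - 1\<close>. At order six the matching is extremal.\<close>

lemma gain_matching_less:
  assumes "finite V" "v \<in> V" "card V \<ge> 8" "\<And>v. v \<in> V \<Longrightarrow> card (nbh E V v) = 1"
  shows "64 * gain E V v < 27 * 2 ^ (card V - 1) + 64 * (card V - 1)"
proof -
  obtain u where u: "u \<in> V" "u \<noteq> v" "nbh E V v = {u}" "nbh E V u = {v}"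
    "\<And>w. w \<in> V - {v, u} \<Longrightarrow> card (nbh E (V - {v, u}) w) = 1"
    using matching_partner[OF assms(4,2)] by blast
  define H where "H = V - {v, u}"
  have H: "finite H" "card V = card H + 2"
    using card_remove_two_eq[OF assms(1,2) u(1,2)] assms(1) unfolding H_def by simp_all
  obtain j where j: "card H = 2 * j" "num_indep E H = 3 ^ j" "3 * num_near E H = j * 3 ^ j"
    using perfect_matching_counts[OF H(1), of E] u(5) unfolding H_def by blast
  have "H - {v} = H" "H \<inter> {v} = {}" by (auto simp: H_def)
  then have gain: "gain E V v = num_near E H + num_indep E H + card H"
    using gain_pendant[OF assms(1,2) u(3)] u(4) unfolding H_def[symmetric] by simp
  have "64 * ((j + 3) * 3 ^ j) \<le> 162 * 4 ^ j" if "j \<ge> 3" for j :: nat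
    using that
  proof (induction j rule: nat_induct_at_least)
    case (Suc j)
    have "64 * ((Suc j + 3) * 3 ^ Suc j) = 64 * 3 ^ j * (3 * (j + 4))" by (simp add: algebra_simps)
    also have "\<dots> \<le> 64 * 3 ^ j * (4 * (j + 3))" by (intro mult_le_mono2) simp
    also have "\<dots> = 4 * (64 * ((j + 3) * 3 ^ j))" by (simp add: algebra_simps)
    also have "\<dots> \<le> 4 * (162 * 4 ^ j)" using Suc.IH by (rule mult_le_mono2)
    finally show ?case by simp
  qed simp
  from this[of j] have "64 * (j * 3 ^ j + 3 * 3 ^ j) \<le> 162 * 4 ^ j"
    using assms(3) H(2) j(1) by (simp add: algebra_simps)
  then have "3 * (64 * (num_near E H + num_indep E H)) \<le> 3 * (54 * 4 ^ j)"
    using j by simp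
  then have "64 * (num_near E H + num_indep E H) \<le> 54 * 4 ^ j" by simp
  moreover have "(2 :: nat) ^ (card V - 1) = 2 * 4 ^ j"
    using H(2) j(1) by (simp add: power_mult)
  ultimately show ?thesis using gain H(2) by simp
qed

text \<open>If the neighbour \<open>u\<close> also has degree 1, then \<open>{u, v}\<close> is an
  isolated edge. Any other vertex misses itself, \<open>u\<close> and \<open>v\<close>, so it cannot
  have degree \<open>card V - 2\<close>, and the whole graph is a matching.\<close>

lemma gain_extreme_degrees_less:
  assumes "finite V" "card V \<ge> 6" "v \<in> V" "card (nbh E V v) = 1" "\<not> three_edges E V"
    and deg: "\<And>x. x \<in> V \<Longrightarrow> card (nbh E V x) = 1 \<or> card (nbh E V x) = card V - 2"
  shows "64 * gain E V v < 27 * 2 ^ (card V - 1) + 64 * (card V - 1)"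
proof -
  obtain u where u: "nbh E V v = {u}" using assms(4) by (auto simp: card_1_singleton_iff)
  have uV: "u \<in> V" "u \<noteq> v" using u by (auto simp: nbh_def)
  then have vu: "v \<in> nbh E V u" using u by (intro nbh_sym[OF _ assms(3)]) simp
  show ?thesis
  proof (cases "card (nbh E V u) = 1")
    case False
    then have "card (nbh E V u) \<ge> 3" using deg[OF uV(1)] assms(2) by auto
    then show ?thesis by (intro gain_pendant_less[OF assms(1,3) u _ assms(2)])
  next
    case True
    then have u': "nbh E V u = {v}" using vu by (auto simp: card_1_singleton_iff)
    have all1: "card (nbh E V x) = 1" if x: "x \<in> V" for x
    proof (rule ccontr)
      assume not1: "card (nbh E V x) \<noteq> 1"
      then have xuv: "x \<noteq> u" "x \<noteq> v" using u u' by auto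
      have "u \<notin> nbh E V x" "v \<notin> nbh E V x"
        using nbh_sym[of u E V x] nbh_sym[of v E V x] x u u' xuv by auto
      then have "nbh E V x \<subseteq> V - {x, u, v}" by (auto simp: nbh_def)
      then have "card (nbh E V x) \<le> card (V - {x, u, v})" using assms(1) by (intro card_mono) auto
      also have "\<dots> = card V - 3"
        using assms(1,3) uV x xuv by (subst card_Diff_subset) auto
      finally show False using deg[OF x] not1 assms(2) by linarith
    qed
    have "even (card V)" using perfect_matching_counts[OF assms(1) all1] by auto
    moreover have "card V \<noteq> 6" using three_edges_matching[OF assms(1) _ all1] assms(5) by blast
    ultimately have "card V \<ge> 8" using assms(2) by presburger
    then show ?thesis by (rule gain_matching_less[OF assms(1,3) _ all1])
  qed
qed

lemma exists_gain_less:
  assumes "finite V" "card V \<ge> 6"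
    and iso: "\<And>x. x \<in> V \<Longrightarrow> nbh E V x \<noteq> {}" "\<And>x. x \<in> V \<Longrightarrow> nbh (- E) V x \<noteq> {}"
    and no3: "\<not> three_edges E V" "\<not> three_edges (- E) V"
  obtains v where "v \<in> V" "64 * gain E V v < 27 * 2 ^ (card V - 1) + 64 * (card V - 1)"
proof -
  have deg: "card (nbh E V v) + card (nbh (- E) V v) = card V - 1"
    and comp: "gain (- E) V v = gain E V v"
    and pos: "card (nbh E V v) > 0" "card (nbh (- E) V v) > 0" if "v \<in> V" for v
    using degree_compl[OF assms(1) that, of E] gain_compl[OF assms(1) that, of E] iso[OF that] assms(1)
    by (auto simp: card_gt_0_iff)
  consider (large) v where "v \<in> V" "card (nbh E V v) \<ge> 3" "card (nbh E V v) + 4 \<le> card V"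
    | (two) v where "v \<in> V" "card (nbh E V v) = 2"
    | (two') v where "v \<in> V" "card (nbh (- E) V v) = 2"
    | (extreme) "\<And>v. v \<in> V \<Longrightarrow> card (nbh E V v) = 1 \<and> card (nbh (- E) V v) = card V - 2
        \<or> card (nbh (- E) V v) = 1 \<and> card (nbh E V v) = card V - 2"
  proof -
    have "(card (nbh E V v) \<ge> 3 \<and> card (nbh E V v) + 4 \<le> card V) \<or> card (nbh E V v) = 2
        \<or> card (nbh (- E) V v) = 2 \<or> card (nbh E V v) = 1 \<and> card (nbh (- E) V v) = card V - 2
        \<or> card (nbh (- E) V v) = 1 \<and> card (nbh E V v) = card V - 2" if "v \<in> V" for v
      using deg[OF that] pos[OF that] assms(2) by linarith
    then show thesis using that by blast
  qed
  then show thesis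
  proof cases
    case large
    then show thesis using that gain_large_less[OF assms(1)] by blast
  next
    case two
    then show thesis using that gain_two_less[OF assms(1) _ _ assms(2) iso(1)] by blast
  next
    case two'
    then have "64 * gain (- E) V v < 27 * 2 ^ (card V - 1) + 64 * (card V - 1)"
      using gain_two_less[OF assms(1) _ _ assms(2) iso(2)] by blast
    then show thesis using that two'(1) comp by simp
  next
    case extreme
    have "V \<noteq> {}" using assms(2) by auto
    then obtain v where v: "v \<in> V" by blast
    from extreme[OF v] show thesis
    proof (elim disjE conjE)
      assume "card (nbh E V v) = 1"
      then show thesis
        using that v gain_extreme_degrees_less[OF assms(1,2) v _ no3(1)] extreme by blast
    next
      assume "card (nbh (- E) V v) = 1"
      then have "64 * gain (- E) V v < 27 * 2 ^ (card V - 1) + 64 * (card V - 1)"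
        using gain_extreme_degrees_less[OF assms(1,2) v _ no3(2)] extreme by blast
      then show thesis using that v comp by simp
    qed
  qed
qed

text \<open>Separates the two extremal types: if the complement consists of three disjoint edges,
  then \<open>num_near\<close> of the graph is \<open>(n choose 2) - 3\<close>, which is less than
  the maximal density allows.\<close>

lemma choose_two_less: "n \<ge> 5 \<Longrightarrow> 64 * (n choose 2) < 27 * 2 ^ n + 192"
proof (induction n rule: nat_induct_at_least)
  case base
  then show ?case by (simp add: choose_two)
next
  case (Suc n)
  then show ?case using mult_le_power_two[of n] by (simp add: numeral_2_eq_2)
qed

text \<open>The claimed bound, multiplied by 64 and increased by 192 to avoid fractions and subtraction.\<close>

definition near_excess :: "nat \<Rightarrow> nat" where
  "near_excess n = 27 * 2 ^ n + 64 * (n choose 2)"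

lemma near_excess_Suc: "near_excess (Suc n) = near_excess n + 27 * 2 ^ n + 64 * n"
  by (simp add: near_excess_def numeral_2_eq_2)

lemma near_total_bound_isolated:
  assumes "finite V" "card V = Suc n" "n \<ge> 5" "x \<in> V" "nbh E V x = {}"
    and IH: "64 * near_total E (V - {x}) + 192 \<le> near_excess n"
      "64 * near_total E (V - {x}) + 192 = near_excess n
        \<Longrightarrow> three_edges E (V - {x}) \<or> three_edges (- E) (V - {x})"
  shows "64 * near_total E V + 192 \<le> near_excess (Suc n) \<and>
    (64 * near_total E V + 192 = near_excess (Suc n) \<longrightarrow> three_edges E V)"
proof -
  have W: "finite (V - {x})" "card (V - {x}) = n" using assms by simp_all
  have total: "near_total E V = near_total E (V - {x}) + num_near E (V - {x}) + n"
    using near_total_remove[OF assms(1,4), of E] gain_isolated[OF assms(1,4,5)] assms(2) by simp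
  have near: "64 * num_near E (V - {x}) \<le> 27 * 2 ^ n" using num_near_bound[OF W(1), of E] W(2) by simp
  have "three_edges E V" if "64 * near_total E V + 192 = near_excess (Suc n)"
  proof -
    have eq: "64 * near_total E (V - {x}) + 192 = near_excess n" "64 * num_near E (V - {x}) = 27 * 2 ^ n"
      using that total near IH(1) by (simp_all add: near_excess_Suc)
    \<comment> \<open>Equality forces the density 27/64 on \<open>V - {x}\<close>, which the
      complement of three edges does not reach.\<close>
    have "\<not> three_edges (- E) (V - {x})"
      using three_edges_counts(2)[OF W(1), of "- E"] eq(2) W(2) choose_two_less[OF assms(3)] by auto
    then have "three_edges E (V - {x})" using IH(2)[OF eq(1)] by blast
    then show ?thesis by (rule three_edges_isolated[OF assms(4,5)])
  qed
  then show ?thesis using total near IH(1) by (simp add: near_excess_Suc)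
qed

theorem near_total_bound:
  assumes "finite V" "card V \<ge> 5"
  shows "64 * near_total E V + 192 \<le> near_excess (card V) \<and>
    (64 * near_total E V + 192 = near_excess (card V) \<longrightarrow> three_edges E V \<or> three_edges (- E) V)"
proof -
  \<comment> \<open>The edge set is quantified because a vertex adjacent to all others is treated as
    an isolated vertex of \<open>- E\<close>.\<close>
  have "\<forall>E V. finite V \<longrightarrow> card (V :: 'a set) = n \<longrightarrow> 64 * near_total E V + 192 \<le> near_excess n \<and>
      (64 * near_total E V + 192 = near_excess n \<longrightarrow> three_edges E V \<or> three_edges (- E) V)"
    if "n \<ge> 5" for n
    using that
  proof (induction n rule: nat_induct_at_least)
    case base
    \<comment> \<open>Since \<open>64 * 20 + 192 = 1472\<close>, the inequality is strict and the
      equality clause is vacuous at order five.\<close>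
    have "near_excess 5 = 1504" by (simp add: near_excess_def choose_two)
    then have "64 * near_total E V + 192 < near_excess 5" if "finite V" "card V = 5"
      for E and V :: "'a set"
      using near_total_five[OF that, of E] by simp
    then show ?case by (metis less_imp_le less_irrefl)
  next
    case (Suc n)
    show ?case
    proof (intro allI impI)
      fix E and V :: "'a set"
      assume V: "finite V" "card V = Suc n"
      have IH: "64 * near_total E (V - {x}) + 192 \<le> near_excess n"
        "64 * near_total E (V - {x}) + 192 = near_excess n
          \<Longrightarrow> three_edges E (V - {x}) \<or> three_edges (- E) (V - {x})" if "x \<in> V" for x E
      proof -
        have "finite (V - {x})" "card (V - {x}) = n" using that V by simp_all
        then show "64 * near_total E (V - {x}) + 192 \<le> near_excess n"
          "64 * near_total E (V - {x}) + 192 = near_excess n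
            \<Longrightarrow> three_edges E (V - {x}) \<or> three_edges (- E) (V - {x})"
          using Suc.IH by blast+
      qed
      consider (iso) x where "x \<in> V" "nbh E V x = {}" | (full) x where "x \<in> V" "nbh (- E) V x = {}"
        | (three) "three_edges E V \<or> three_edges (- E) V"
        | (other) "\<forall>x\<in>V. nbh E V x \<noteq> {}" "\<forall>x\<in>V. nbh (- E) V x \<noteq> {}"
          "\<not> three_edges E V" "\<not> three_edges (- E) V"
        by blast
      then show "64 * near_total E V + 192 \<le> near_excess (Suc n) \<and>
          (64 * near_total E V + 192 = near_excess (Suc n) \<longrightarrow> three_edges E V \<or> three_edges (- E) V)"
      proof cases
        case iso
        then show ?thesis
          using near_total_bound_isolated[OF V Suc.hyps iso IH(1)[OF iso(1)] IH(2)[OF iso(1)]] by blast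
      next
        case full
        then show ?thesis
          using near_total_bound_isolated[OF V Suc.hyps full IH(1)[OF full(1)] IH(2)[OF full(1)]]
          by (simp add: near_total_compl)
      next
        case three
        \<comment> \<open>These graphs attain the bound and have to be removed before a strict gain
          is sought; only at order six do they lack both an isolated and a dominating
          vertex.\<close>
        have "64 * near_total E V + 192 = near_excess (Suc n)"
          using three
        proof
          assume "three_edges E V"
          from three_edges_counts[OF V(1) this] show ?thesis
            by (simp add: near_total_def near_excess_def V(2))
        next
          assume "three_edges (- E) V"
          from three_edges_counts[OF V(1) this] show ?thesis
            by (simp add: near_total_def near_excess_def V(2))
        qed
        then show ?thesis using three by simp
      next
        case other
        obtain v where v: "v \<in> V" "64 * gain E V v < 27 * 2 ^ (card V - 1) + 64 * (card V - 1)"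
          by (rule exists_gain_less[of V E]) (use other V Suc.hyps in auto)
        have "64 * near_total E V + 192 < near_excess (Suc n)"
          using near_total_remove[OF V(1) v(1), of E] IH(1)[OF v(1), of E] v(2) V(2)
          by (simp add: near_excess_Suc)
        then show ?thesis by simp
      qed
    qed
  qed
  from this[OF assms(2)] show ?thesis using assms(1) by blast
qed

section \<open>Isomorphism with the extremal graphs\<close>

text \<open>Comparing only distinct \<open>u\<close> and \<open>v\<close> makes the notion invariant under complementing both edge
  sets, which need not consist of pairs.\<close>

definition iso_on :: "'a set set \<Rightarrow> 'a set \<Rightarrow> 'b set set \<Rightarrow> 'b set \<Rightarrow> bool" where
  "iso_on E V E' V' \<longleftrightarrow> (\<exists>f. bij_betw f V V' \<and>
     (\<forall>u\<in>V. \<forall>v\<in>V. u \<noteq> v \<longrightarrow> ({u, v} \<in> E \<longleftrightarrow> {f u, f v} \<in> E')))"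

lemma isomorphic_iff_iso_on:
  assumes "edges G \<subseteq> all_pairs (verts G)" "edges H \<subseteq> all_pairs (verts H)"
  shows "isomorphic G H \<longleftrightarrow> iso_on (edges G) (verts G) (edges H) (verts H)"
proof -
  have "{u, u} \<notin> edges G" "{w, w} \<notin> edges H" for u w
    using assms by (auto simp: all_pairs_def)
  then have "(\<forall>u\<in>verts G. \<forall>v\<in>verts G. {u, v} \<in> edges G \<longleftrightarrow> {f u, f v} \<in> edges H) \<longleftrightarrow>
      (\<forall>u\<in>verts G. \<forall>v\<in>verts G. u \<noteq> v \<longrightarrow> ({u, v} \<in> edges G \<longleftrightarrow> {f u, f v} \<in> edges H))" for f
    by (intro ball_cong refl) (metis)
  then show ?thesis by (simp add: isomorphic_def iso_on_def)
qed

lemma iso_on_compl: "iso_on (- E) V (- E') V' \<longleftrightarrow> iso_on E V E' V'"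
  by (simp add: iso_on_def)

lemma iso_on_sym:
  assumes "iso_on E V E' V'"
  shows "iso_on E' V' E V"
proof -
  obtain f where f: "bij_betw f V V'"
    "\<And>u v. u \<in> V \<Longrightarrow> v \<in> V \<Longrightarrow> u \<noteq> v \<Longrightarrow> {u, v} \<in> E \<longleftrightarrow> {f u, f v} \<in> E'"
    using assms unfolding iso_on_def by blast
  define g where "g = the_inv_into V f"
  have g: "bij_betw g V' V" unfolding g_def using f(1) by (rule bij_betw_the_inv_into)
  have gf: "f (g w) = w" "g w \<in> V" if "w \<in> V'" for w
    using f_the_inv_into_f_bij_betw[OF f(1) that] bij_betw_apply[OF g that] by (simp_all add: g_def)
  have "{u, v} \<in> E' \<longleftrightarrow> {g u, g v} \<in> E" if "u \<in> V'" "v \<in> V'" "u \<noteq> v" for u v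
  proof -
    have "g u \<noteq> g v" using gf(1)[OF that(1)] gf(1)[OF that(2)] that(3) by metis
    then show ?thesis using f(2)[of "g u" "g v"] gf that by simp
  qed
  then show ?thesis unfolding iso_on_def using g by blast
qed

lemma iso_on_trans:
  assumes "iso_on E V E' V'" "iso_on E' V' E'' V''"
  shows "iso_on E V E'' V''"
proof -
  obtain f where f: "bij_betw f V V'"
    "\<And>u v. u \<in> V \<Longrightarrow> v \<in> V \<Longrightarrow> u \<noteq> v \<Longrightarrow> {u, v} \<in> E \<longleftrightarrow> {f u, f v} \<in> E'"
    using assms(1) unfolding iso_on_def by blast
  obtain g where g: "bij_betw g V' V''"
    "\<And>u v. u \<in> V' \<Longrightarrow> v \<in> V' \<Longrightarrow> u \<noteq> v \<Longrightarrow> {u, v} \<in> E' \<longleftrightarrow> {g u, g v} \<in> E''"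
    using assms(2) unfolding iso_on_def by blast
  have "{u, v} \<in> E \<longleftrightarrow> {(g \<circ> f) u, (g \<circ> f) v} \<in> E''" if "u \<in> V" "v \<in> V" "u \<noteq> v" for u v
  proof -
    have "f u \<noteq> f v" using f(1) that by (auto simp: bij_betw_def inj_on_def)
    then show ?thesis using f(2)[OF that] g(2)[of "f u" "f v"] bij_betw_apply[OF f(1)] that by simp
  qed
  then show ?thesis unfolding iso_on_def using bij_betw_trans[OF f(1) g(1)] by blast
qed

text \<open>A fixed model on an initial segment of the naturals serves as the common reference.
  Listing \<open>V\<close> with the six endpoints in front turns indexing into the
  isomorphism.\<close>

lemma three_edges_iff_iso_on:
  fixes V :: "'a set"
  assumes "finite V" "card V = n" "n \<ge> 6"
  shows "three_edges E V \<longleftrightarrow> iso_on {{0, 1}, {2, 3}, {4, 5}} {..<n} E V"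
proof
  assume "three_edges E V"
  then obtain a b c d e f where dist: "distinct [a, b, c, d, e, f]" and sub: "{a, b, c, d, e, f} \<subseteq> V"
    and E: "all_pairs V \<inter> E = {{a, b}, {c, d}, {e, f}}"
    unfolding three_edges_def by (elim exE conjE) (rule that)
  obtain xs where xs: "set xs = V - {a, b, c, d, e, f}" "distinct xs"
    using finite_distinct_list[of "V - {a, b, c, d, e, f}"] assms(1) by auto
  define ys where "ys = [a, b, c, d, e, f] @ xs"
  have ys: "distinct ys" "set ys = V" using xs dist sub by (auto simp: ys_def)
  then have len: "length ys = n" using assms(2) distinct_card by fastforce
  have bij: "bij_betw ((!) ys) {..<n} V"
    using ys len by (intro bij_betw_nth) auto
  have key: "{i, j} \<in> {{0, 1}, {2, 3}, {4, 5}} \<longleftrightarrow> {ys ! i, ys ! j} \<in> E"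
    if ij: "i \<in> {..<n}" "j \<in> {..<n}" "i \<noteq> j" for i j
  proof -
    have inj: "ys ! k = ys ! l \<longleftrightarrow> k = l" if "k < n" "l < n" for k l
      using that ys(1) len by (simp add: nth_eq_iff_index_eq)
    have "ys ! i \<in> V" "ys ! j \<in> V" "ys ! i \<noteq> ys ! j"
      using ij bij_betw_apply[OF bij] inj by auto
    then have "{ys ! i, ys ! j} \<in> E \<longleftrightarrow> {ys ! i, ys ! j} \<in> all_pairs V \<inter> E"
      by (simp add: pair_in_all_pairs)
    also have "\<dots> \<longleftrightarrow> {ys ! i, ys ! j} \<in> {{ys ! 0, ys ! 1}, {ys ! 2, ys ! 3}, {ys ! 4, ys ! 5}}"
      unfolding E by (simp add: ys_def)
    also have "\<dots> \<longleftrightarrow> {i, j} \<in> {{0, 1}, {2, 3}, {4, 5}}"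
      using ij assms(3) by (simp add: doubleton_eq_iff inj)
    finally show ?thesis ..
  qed
  show "iso_on {{0, 1}, {2, 3}, {4, 5}} {..<n} E V"
    unfolding iso_on_def
    by (rule exI[of _ "(!) ys"], intro conjI ballI impI) (rule bij, rule key)
next
  assume "iso_on {{0, 1}, {2, 3}, {4, 5}} {..<n} E V"
  then obtain h where h: "bij_betw h {..<n} V" and H: "\<forall>i\<in>{..<n}. \<forall>j\<in>{..<n}. i \<noteq> j \<longrightarrow>
      ({i, j} \<in> {{0, 1}, {2, 3}, {4, 5}} \<longleftrightarrow> {h i, h j} \<in> E)"
    unfolding iso_on_def by (elim exE conjE) (rule that)
  have edge: "{i, j} \<in> {{0, 1}, {2, 3}, {4, 5}} \<longleftrightarrow> {h i, h j} \<in> E"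
    if "i < n" "j < n" "i \<noteq> j" for i j
    by (rule H[rule_format]) (use that in simp_all)
  have inj: "h k = h l \<longleftrightarrow> k = l" if "k < n" "l < n" for k l
    using h that by (auto simp: bij_betw_def inj_on_def)
  have hV: "h k \<in> V" if "k < n" for k
    using bij_betw_apply[OF h] that by simp
  have "all_pairs V \<inter> E = {{h 0, h 1}, {h 2, h 3}, {h 4, h 5}}"
  proof (intro equalityI subsetI)
    fix e assume e: "e \<in> all_pairs V \<inter> E"
    then obtain p q where pq: "e = {p, q}" "p \<noteq> q" "p \<in> V" "q \<in> V"
      by (auto simp: all_pairs_def card_2_iff)
    have "V = h ` {..<n}" using h by (simp add: bij_betw_def)
    then obtain i j where ij: "p = h i" "q = h j" "i < n" "j < n"
      using pq(3,4) by auto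
    have ne: "i \<noteq> j" "{h i, h j} \<in> E" using pq e ij by auto
    have "{i, j} \<in> {{0, 1}, {2, 3}, {4, 5}}" by (rule iffD2[OF edge[OF ij(3,4) ne(1)] ne(2)])
    then show "e \<in> {{h 0, h 1}, {h 2, h 3}, {h 4, h 5}}"
      unfolding pq(1) ij(1,2) by (elim insertE emptyE) (auto simp: doubleton_eq_iff)
  next
    fix e assume e: "e \<in> {{h 0, h 1}, {h 2, h 3}, {h 4, h 5}}"
    have "{h i, h j} \<in> all_pairs V \<inter> E"
      if "i < n" "j < n" "i \<noteq> j" "{i, j} \<in> {{0, 1}, {2, 3}, {4, 5}}" for i j
      using that(1-3) inj hV iffD1[OF edge[OF that(1-3)] that(4)] by (simp add: pair_in_all_pairs)
    from this[of 0 1] this[of 2 3] this[of 4 5] show "e \<in> all_pairs V \<inter> E"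
      using e assms(3) by (elim insertE emptyE) simp_all
  qed
  moreover have "distinct [h 0, h 1, h 2, h 3, h 4, h 5]" "{h 0, h 1, h 2, h 3, h 4, h 5} \<subseteq> V"
    using assms(3) by (simp_all add: inj hV)
  ultimately have "distinct [h 0, h 1, h 2, h 3, h 4, h 5] \<and> {h 0, h 1, h 2, h 3, h 4, h 5} \<subseteq> V
      \<and> all_pairs V \<inter> E = {{h 0, h 1}, {h 2, h 3}, {h 4, h 5}}"
    by (intro conjI)
  then show "three_edges E V" unfolding three_edges_def by (intro exI)
qed

text \<open>Both graphs are compared through the model of the same order.\<close>

lemma three_edges_iso_on:
  assumes "finite V" "finite V'" "card V = card V'" "card V \<ge> 6" "three_edges E' V'"
  shows "three_edges E V \<longleftrightarrow> iso_on E V E' V'"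
proof -
  have V': "iso_on {{0, 1}, {2, 3}, {4, 5}} {..<card V} E' V'"
    using three_edges_iff_iso_on[of V' "card V" E'] assms by simp
  have "three_edges E V \<longleftrightarrow> iso_on {{0, 1}, {2, 3}, {4, 5}} {..<card V} E V"
    using three_edges_iff_iso_on[of V "card V" E] assms by simp
  also have "\<dots> \<longleftrightarrow> iso_on E V E' V'"
    using iso_on_trans[OF iso_on_sym V', of E V] iso_on_trans[OF V' iso_on_sym, of E V] by blast
  finally show ?thesis .
qed

section \<open>The two extremal graphs and the final translation\<close>

lemma three_edges_union_edgeless:
  fixes m :: nat
  defines "K \<equiv> disjoint_union three_K2 (edgeless_graph m)"
  shows "finite (verts K)" "card (verts K) = 6 + m" "edges K \<subseteq> all_pairs (verts K)"
    "three_edges (edges K) (verts K)"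
proof -
  have V: "verts K = verts three_K2 <+> {..<m}"
    by (simp add: K_def disjoint_union_def edgeless_graph_def)
  have E: "edges K = {{Inl (Inl (Inl 0)), Inl (Inl (Inl 1))}, {Inl (Inl (Inr 0)), Inl (Inl (Inr 1))},
      {Inl (Inr 0), Inl (Inr 1)}}"
    by (simp add: K_def disjoint_union_def edgeless_graph_def edges_three_K2)
  show "finite (verts K)" unfolding V by (simp add: verts_three_K2)
  show "card (verts K) = 6 + m" unfolding V by (simp add: card_Plus verts_three_K2)
  show sub: "edges K \<subseteq> all_pairs (verts K)"
    unfolding V E by (auto simp: pair_in_all_pairs verts_three_K2)
  have "distinct [Inl (Inl (Inl 0)), Inl (Inl (Inl 1)), Inl (Inl (Inr 0)), Inl (Inl (Inr 1)),
      Inl (Inr 0), Inl (Inr 1) :: ((nat + nat) + nat) + nat] \<and>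
    {Inl (Inl (Inl 0)), Inl (Inl (Inl 1)), Inl (Inl (Inr 0)), Inl (Inl (Inr 1)),
      Inl (Inr 0), Inl (Inr 1)} \<subseteq> verts K \<and>
    all_pairs (verts K) \<inter> edges K = {{Inl (Inl (Inl 0)), Inl (Inl (Inl 1))},
      {Inl (Inl (Inr 0)), Inl (Inl (Inr 1))}, {Inl (Inr 0), Inl (Inr 1)}}"
    using sub E by (auto simp: V verts_three_K2)
  then show "three_edges (edges K) (verts K)"
    unfolding three_edges_def by (intro exI)
qed

text \<open>Every pair with an end in the complete part is adjacent, so the non-adjacent pairs lie
  in the copy of \<open>G64\<close> and are the edges of \<open>three_K2\<close> there. The join is
  thus recognised through its complement.\<close>

lemma three_edges_join_complete:
  fixes m :: nat
  defines "K \<equiv> join (complete_graph m) G64"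
  shows "finite (verts K)" "card (verts K) = 6 + m" "edges K \<subseteq> all_pairs (verts K)"
    "three_edges (- edges K) (verts K)"
proof -
  have V: "verts K = {..<m} <+> verts three_K2"
    by (simp add: K_def join_def disjoint_union_def complete_graph_def verts_G64)
  have E: "edges K = (\<lambda>e. Inl ` e) ` all_pairs {..<m} \<union> (\<lambda>e. Inr ` e) ` edges G64
      \<union> {{Inl u, Inr v} | u v. u \<in> {..<m} \<and> v \<in> verts three_K2}"
    by (simp add: K_def join_def disjoint_union_def complete_graph_def verts_G64)
  show "finite (verts K)" unfolding V by (simp add: verts_three_K2)
  show "card (verts K) = 6 + m" unfolding V by (simp add: card_Plus verts_three_K2)
  have G64: "edges G64 = all_pairs (verts three_K2) - edges three_K2"
    by (simp add: G64_def complement_def)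
  have inj: "inj (image Inl)" "inj (image Inr)"
    by (auto intro!: injI simp: inj_image_eq_iff)
  have ll: "{Inl p, Inl q} \<in> edges K \<longleftrightarrow> {p, q} \<in> all_pairs {..<m}" for p q
  proof -
    have "{Inl p, Inl q} \<notin> (\<lambda>e. Inr ` e) ` edges G64" by auto
    then show ?thesis
      using inj_image_mem_iff[OF inj(1), of "{p, q}" "all_pairs {..<m}"]
      unfolding E by (simp add: doubleton_eq_iff)
  qed
  have rr: "{Inr p, Inr q} \<in> edges K \<longleftrightarrow> {p, q} \<in> edges G64" for p q
  proof -
    have "{Inr p, Inr q} \<notin> (\<lambda>e. Inl ` e) ` all_pairs {..<m}" by auto
    then show ?thesis
      using inj_image_mem_iff[OF inj(2), of "{p, q}" "edges G64"]
      unfolding E by (simp add: doubleton_eq_iff)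
  qed
  have lr: "{Inl p, Inr q} \<in> edges K" if "p < m" "q \<in> verts three_K2" for p q
    using that unfolding E by auto
  have pairs: "e \<in> all_pairs (verts K) - edges K
      \<longleftrightarrow> e \<in> (\<lambda>e. Inr ` e) ` edges three_K2" for e
  proof
    assume e: "e \<in> all_pairs (verts K) - edges K"
    then obtain p q where pq: "e = {p, q}" "p \<noteq> q" "p \<in> verts K" "q \<in> verts K" "{p, q} \<notin> edges K"
      by (auto simp: all_pairs_def card_2_iff)
    show "e \<in> (\<lambda>e. Inr ` e) ` edges three_K2"
    proof (cases p)
      case p: (Inl a)
      show ?thesis
      proof (cases q)
        case (Inl b)
        then show ?thesis using pq p ll[of a b] by (auto simp: V pair_in_all_pairs)
      next
        case (Inr b)
        then show ?thesis using pq p lr[of a b] by (auto simp: V)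
      qed
    next
      case p: (Inr a)
      show ?thesis
      proof (cases q)
        case (Inl b)
        then show ?thesis using pq p lr[of b a] by (auto simp: V insert_commute)
      next
        case (Inr b)
        then have "{a, b} \<in> edges three_K2"
          using pq p rr[of a b] by (auto simp: V G64 pair_in_all_pairs)
        moreover have "e = Inr ` {a, b}" using pq(1) p Inr by simp
        ultimately show ?thesis by (rule rev_image_eqI)
      qed
    qed
  next
    assume "e \<in> (\<lambda>e. Inr ` e) ` edges three_K2"
    then show "e \<in> all_pairs (verts K) - edges K"
      unfolding edges_three_K2
      by (auto simp: pair_in_all_pairs V verts_three_K2 rr G64 edges_three_K2)
  qed
  show "edges K \<subseteq> all_pairs (verts K)"
    unfolding E V G64 by (auto simp: all_pairs_def card_image)
  have "all_pairs (verts K) \<inter> - edges K = (\<lambda>e. Inr ` e) ` edges three_K2"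
    using pairs by blast
  then have "all_pairs (verts K) \<inter> - edges K = {{Inr (Inl (Inl 0)), Inr (Inl (Inl 1))},
      {Inr (Inl (Inr 0)), Inr (Inl (Inr 1))}, {Inr (Inr 0), Inr (Inr 1)}}"
    by (simp add: edges_three_K2)
  then have "distinct [Inr (Inl (Inl 0)), Inr (Inl (Inl 1)), Inr (Inl (Inr 0)), Inr (Inl (Inr 1)),
      Inr (Inr 0), Inr (Inr 1) :: nat + ((nat + nat) + nat)] \<and>
    {Inr (Inl (Inl 0)), Inr (Inl (Inl 1)), Inr (Inl (Inr 0)), Inr (Inl (Inr 1)),
      Inr (Inr 0), Inr (Inr 1)} \<subseteq> verts K \<and>
    all_pairs (verts K) \<inter> - edges K = {{Inr (Inl (Inl 0)), Inr (Inl (Inl 1))},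
      {Inr (Inl (Inr 0)), Inr (Inl (Inr 1))}, {Inr (Inr 0), Inr (Inr 1)}}"
    by (auto simp: V verts_three_K2)
  then show "three_edges (- edges K) (verts K)"
    unfolding three_edges_def by (intro exI)
qed

lemma sigma1_eq_num_near:
  assumes "edges G \<subseteq> all_pairs (verts G)"
  shows "sigma1 G = num_near (edges G) (verts G)"
proof -
  have "{e \<in> edges G. e \<subseteq> S} = all_pairs S \<inter> edges G" for S
    using assms by (auto simp: all_pairs_def)
  then show ?thesis
    by (simp add: sigma1_def nearly_independent1_def induced_subgraph_def num_near_def num_edges_def)
qed

lemma sigma1_complement_eq_num_near:
  "sigma1 (complement G) = num_near (- edges G) (verts G)"
proof -
  have "{e \<in> all_pairs (verts G) - edges G. e \<subseteq> S} = all_pairs S \<inter> - edges G" if "S \<subseteq> verts G" for S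
    using that by (auto simp: all_pairs_def)
  then show ?thesis
    by (auto simp: sigma1_def nearly_independent1_def induced_subgraph_def num_near_def num_edges_def
        complement_def intro!: arg_cong[where f = card])
qed

theorem theorem4:
  fixes G :: "'a graph" and n :: nat
  assumes "simple_graph G" and "order G = n" and "n \<ge> 6"
  shows "real (sigma1 G) + real (sigma1 (complement G))
           \<le> 27 / 64 * 2 ^ n + 1 / 2 * (real n + 2) * (real n - 3)
       \<and> (real (sigma1 G) + real (sigma1 (complement G))
           = 27 / 64 * 2 ^ n + 1 / 2 * (real n + 2) * (real n - 3)
          \<longleftrightarrow> isomorphic G (disjoint_union three_K2 (edgeless_graph (n - 6)))
            \<or> isomorphic G (join (complete_graph (n - 6)) G64))"
proof -
  define E V where "E = edges G" and "V = verts G"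
  have V: "finite V" "card V = n" and E: "E \<subseteq> all_pairs V"
    using assms(1,2) by (simp_all add: simple_graph_def order_def E_def V_def)
  define s where "s = near_total E V"
  have sigma: "real (sigma1 G) + real (sigma1 (complement G)) = real s"
    using sigma1_eq_num_near[of G] E
    by (simp add: sigma1_complement_eq_num_near s_def near_total_def E_def V_def)
  have bound: "64 * s + 192 \<le> near_excess n"
    and eq: "64 * s + 192 = near_excess n \<Longrightarrow> three_edges E V \<or> three_edges (- E) V"
    using near_total_bound[of V E] V assms(3) by (simp_all add: s_def)
  have eq_iff: "64 * s + 192 = near_excess n \<longleftrightarrow> three_edges E V \<or> three_edges (- E) V"
  proof
    assume "three_edges E V \<or> three_edges (- E) V"
    then show "64 * s + 192 = near_excess n"
    proof
      assume "three_edges E V"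
      from three_edges_counts[OF V(1) this] show ?thesis
        by (simp add: s_def near_total_def near_excess_def V(2))
    next
      assume "three_edges (- E) V"
      from three_edges_counts[OF V(1) this] show ?thesis
        by (simp add: s_def near_total_def near_excess_def V(2))
    qed
  qed (rule eq)
  have "even (n * (n - 1))" by (cases n) auto
  then have "2 * (n choose 2) = n * (n - 1)"
    by (simp add: choose_two)
  then have "real (2 * (n choose 2)) = real (n * (n - 1))" by (simp only:)
  then have choose: "real (n choose 2) = real n * (real n - 1) / 2"
    using assms(3) by (simp add: of_nat_diff)
  \<comment> \<open>Since \<open>(n + 2) * (n - 3) / 2\<close> is \<open>(n choose 2) - 3\<close>,
    scaling by 64 turns the 3 into the 192 of the natural-number bound.\<close>
  define b :: real where "b = 27 / 64 * 2 ^ n + 1 / 2 * (real n + 2) * (real n - 3)"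
  have excess: "real (near_excess n) = 64 * b + 192"
    using choose by (simp add: near_excess_def b_def field_simps)
  define K where "K = disjoint_union three_K2 (edgeless_graph (n - 6))"
  define L where "L = join (complete_graph (n - 6)) G64"
  note K = three_edges_union_edgeless[of "n - 6", folded K_def]
  note L = three_edges_join_complete[of "n - 6", folded L_def]
  have iso1: "isomorphic G K \<longleftrightarrow> three_edges E V"
  proof -
    have "isomorphic G K \<longleftrightarrow> iso_on E V (edges K) (verts K)"
      using isomorphic_iff_iso_on[OF _ K(3), of G] E by (simp add: E_def V_def)
    also have "\<dots> \<longleftrightarrow> three_edges E V"
      using three_edges_iso_on[OF V(1) K(1) _ _ K(4)] K(2) V(2) assms(3) by simp
    finally show ?thesis .
  qed
  have iso2: "isomorphic G L \<longleftrightarrow> three_edges (- E) V"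
  proof -
    have "isomorphic G L \<longleftrightarrow> iso_on E V (edges L) (verts L)"
      using isomorphic_iff_iso_on[OF _ L(3), of G] E by (simp add: E_def V_def)
    also have "\<dots> \<longleftrightarrow> iso_on (- E) V (- edges L) (verts L)"
      by (simp only: iso_on_compl)
    also have "\<dots> \<longleftrightarrow> three_edges (- E) V"
      using three_edges_iso_on[OF V(1) L(1) _ _ L(4)] L(2) V(2) assms(3) by simp
    finally show ?thesis .
  qed
  have "real (64 * s + 192) \<le> real (near_excess n)" using bound by (rule of_nat_mono)
  moreover have "real (64 * s + 192) = real (near_excess n) \<longleftrightarrow> three_edges E V \<or> three_edges (- E) V"
    unfolding of_nat_eq_iff by (rule eq_iff)
  ultimately have "real s \<le> b" "real s = b \<longleftrightarrow> three_edges E V \<or> three_edges (- E) V"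
    unfolding excess by simp_all
  then show ?thesis
    unfolding K_def[symmetric] L_def[symmetric] sigma iso1 iso2 b_def by blast
qed

end
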